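(* For every fixed $\delta>0$ and every sufficiently large integer $n$ (how large may depend on $\delta$) there exists an $n$-vertex graph $G$ with $$\chi_f(G)\ge \frac{\log\log n}{50\log\log\log n},\qquad \rho(G)\le 4+\delta,$$ and $$\alpha_{\mathrm{deg}_H}(G)\ge \frac{|E(H)|}{4+\delta}\quad\text{for every subgraph } H\subseteq G.$$
   Context: All graphs are finite and simple. $\log$ denotes the natural logarithm. For a graph $G$, $\mathcal{I}(G)$ denotes the collection of independent sets of $G$ and $\alpha(G)$ the maximum size of an independent set. For a weight function $w:V(G)\to[0,\infty)$, $\alpha_w(G)=\max_{I\in\mathcal{I}(G)}\sum_{v\in I}w(v)$ is the maximum total weight of an independent set in $G$. For a (not necessarily induced) subgraph $H$ of $G$, the weight function $\mathrm{deg}_H:V(G)\to\mathbb{N}_0$ is defined by letting $\mathrm{deg}_H(v)$ be the degree of $v$ in $H$ for $v\in V(H)$, and $\mathrm{deg}_H(v)=0$ for $v\in V(G)\setminus V(H)$. The fractional chromatic number $\chi_f(G)$ is the optimal value of the linear program: minimize $\sum_{I\in\mathcal{I}(G)}x_I$ subject to $\sum_{I\in\mathcal{I}(G):\, v\in I}x_I\ge 1$ for all $v\in V(G)$ and $x_I\ge 0$ for all $I\in\mathcal{I}(G)$. Equivalently, $\chi_f(G)=\max_w \frac{\sum_{v\in V(G)}w(v)}{\alpha_w(G)}$ over all $w:V(G)\to[0,\infty)$ with $w\not\equiv 0$. The Hall ratio of $G$ is $\rho(G)=\max_{H\subseteq G}\frac{|V(H)|}{\alpha(H)}$, the maximum being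 over all subgraphs $H$ of $G$ with at least one vertex. *)

theory Defs
  imports Complex_Main "HOL-Library.Ramsey"
begin

text \<open>
  A graph is given by a vertex set \<open>V\<close> and a set \<open>E\<close> of two-element subsets of \<open>V\<close>;
  \<open>[V]\<^bsup>2\<^esup>\<close> and \<open>indep\<close> are those of \<open>HOL-Library.Ramsey\<close>.
\<close>

definition simple_graph :: "'a set \<Rightarrow> 'a set set \<Rightarrow> bool" where
  "simple_graph V E \<longleftrightarrow> finite V \<and> E \<subseteq> [V]\<^bsup>2\<^esup>"

text \<open>Subgraphs need be neither induced nor spanning, and may be empty.\<close>

definition subgraph :: "'a set \<Rightarrow> 'a set set \<Rightarrow> 'a set \<Rightarrow> 'a set set \<Rightarrow> bool" where
  "subgraph W F V E \<longleftrightarrow> simple_graph W F \<and> W \<subseteq> V \<and> F \<subseteq> E"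

definition indep_sets :: "'a set \<Rightarrow> 'a set set \<Rightarrow> 'a set set" where
  "indep_sets V E = {I. I \<subseteq> V \<and> indep I E}"

definition independence_number :: "'a set \<Rightarrow> 'a set set \<Rightarrow> nat" where
  "independence_number V E = Max (card ` indep_sets V E)"

definition weighted_independence_number ::
    "'a set \<Rightarrow> 'a set set \<Rightarrow> ('a \<Rightarrow> real) \<Rightarrow> real" where
  "weighted_independence_number V E w = Max ((\<lambda>I. \<Sum>v\<in>I. w v) ` indep_sets V E)"

definition deg_weight :: "'a set \<Rightarrow> 'a set set \<Rightarrow> 'a \<Rightarrow> nat" where
  "deg_weight W F v = (if v \<in> W then card {e \<in> F. v \<in> e} else 0)"

definition fractional_colouring :: "'a set \<Rightarrow> 'a set set \<Rightarrow> ('a set \<Rightarrow> real) \<Rightarrow> bool" where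
  "fractional_colouring V E x \<longleftrightarrow>
     (\<forall>I\<in>indep_sets V E. 0 \<le> x I) \<and>
     (\<forall>v\<in>V. (\<Sum>I | I \<in> indep_sets V E \<and> v \<in> I. x I) \<ge> 1)"

definition fractional_chromatic_number :: "'a set \<Rightarrow> 'a set set \<Rightarrow> real" where
  "fractional_chromatic_number V E =
     Inf {\<Sum>I\<in>indep_sets V E. x I | x. fractional_colouring V E x}"

definition hall_ratio :: "'a set \<Rightarrow> 'a set set \<Rightarrow> real" where
  "hall_ratio V E =
     Max {real (card W) / real (independence_number W F) | W F. subgraph W F V E \<and> W \<noteq> {}}"

text \<open>For simple graphs the extrema above range over nonempty finite (for \<open>Max\<close>),
  respectively nonempty and bounded below (for \<open>Inf\<close>), sets of values.\<close>

lemma finite_indep_sets: "finite V \<Longrightarrow> finite (indep_sets V E)"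
  by (rule finite_subset[of _ "Pow V"]) (auto simp: indep_sets_def)

lemma empty_in_indep_sets: "{} \<in> indep_sets V E"
  by (simp add: indep_sets_def indep_def)

lemma singleton_in_indep_sets: "v \<in> V \<Longrightarrow> {v} \<in> indep_sets V E"
  by (simp add: indep_sets_def indep_def)

lemma finite_hall_ratio_values:
  assumes "simple_graph V E"
  shows "finite {real (card W) / real (independence_number W F) | W F. subgraph W F V E \<and> W \<noteq> {}}"
proof -
  have "finite (Pow V \<times> Pow E)"
    using assms finite_subset[of E "[V]\<^bsup>2\<^esup>"]
    by (auto simp: simple_graph_def finite_imp_finite_nsets)
  then have "finite ((\<lambda>(W, F). real (card W) / real (independence_number W F)) ` (Pow V \<times> Pow E))"
    by (rule finite_imageI)
  then show ?thesis
    by (rule rev_finite_subset) (auto simp: subgraph_def)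
qed

lemma independence_number_pos:
  assumes "finite W" and "W \<noteq> {}"
  shows "0 < independence_number W F"
proof -
  from assms obtain v where "v \<in> W" by blast
  then have "card {v} \<le> independence_number W F"
    unfolding independence_number_def
    by (intro Max_ge finite_imageI finite_indep_sets imageI singleton_in_indep_sets assms)
  then show ?thesis by simp
qed

lemma fractional_colouring_exists:
  assumes "finite V"
  shows "fractional_colouring V E (\<lambda>_. 1)"
proof -
  have "1 \<le> card {I \<in> indep_sets V E. v \<in> I}" if "v \<in> V" for v
  proof -
    have "{v} \<in> {I \<in> indep_sets V E. v \<in> I}"
      using that by (simp add: singleton_in_indep_sets)
    moreover have "finite {I \<in> indep_sets V E. v \<in> I}"
      using assms by (simp add: finite_indep_sets)
    ultimately show ?thesis
      by (metis One_nat_def Suc_leI card_gt_0_iff empty_iff)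
  qed
  then show ?thesis
    by (simp add: fractional_colouring_def)
qed

lemma bdd_below_fractional_colouring_values:
  "bdd_below {\<Sum>I\<in>indep_sets V E. x I | x. fractional_colouring V E x}"
  by (rule bdd_belowI[of _ 0]) (auto simp: fractional_colouring_def intro!: sum_nonneg)

end

theory Submission
  imports Defs "HOL-Real_Asymp.Real_Asymp"
begin

text \<open>
  The graphs are random. The vertex set is split into \<open>k\<close> levels whose sizes
  \<open>n\<^sub>0 > n\<^sub>1 > \<dots>\<close> shrink so fast that the ratios \<open>n / n\<^sub>s\<close> grow doubly exponentially; this
  leaves room for \<open>k = \<Omega>(log log n)\<close> levels. Every vertex of a level chooses, independently and
  uniformly, one neighbour in each later level, and these choices are the only edges. The
  probabilities are kept as cardinalities: an event is a set of choice functions, compared with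
  the set of all of them.

  \<^emph>\<open>Independent sets are thin.\<close> Let an independent set \<open>I\<close> occupy the fraction \<open>x\<^sub>j\<close> of level \<open>j\<close>. A
  fixed vertex of level \<open>i\<close> avoids \<open>I\<close> with all its choices with probability
  \<open>\<Prod>\<^sub>j\<^sub>>\<^sub>i (1 - x\<^sub>j) \<le> exp (- \<Sum>\<^sub>j\<^sub>>\<^sub>i x\<^sub>j)\<close>. The later levels together are tiny compared with level \<open>i\<close>, so a
  union bound over the trace of \<open>I\<close> on them costs almost nothing, and with high probability
  \<open>x\<^sub>i \<le> 1 / k\<close> as soon as \<open>\<Sum>\<^sub>j\<^sub>>\<^sub>i x\<^sub>j \<ge> log (12 k)\<close> (property \<open>expanding\<close>). Hence
  \<open>\<Sum>\<^sub>j x\<^sub>j \<le> log (12 k) + 2\<close> for every independent set, and the weight that gives each level total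
  weight one certifies a fractional chromatic number of at least \<open>k / (log (12 k) + 2)\<close>.

  \<^emph>\<open>Small sets are sparse.\<close> A first moment computation shows that with high probability every
  nonempty set \<open>X\<close> of vertices in the levels before \<open>s\<close> whose size is at most a large multiple of \<open>n\<^sub>s\<close>
  spans fewer than \<open>3 |X| / 2\<close> edges (property \<open>sparse\<close>). Then every subset of \<open>X\<close> has a vertex of
  degree at most two inside it, so \<open>X\<close> is 3-colourable. Given a size \<open>t\<close>, let \<open>s\<close> be the first level
  after which all levels together are negligible compared with \<open>t\<close>. By minimality \<open>t\<close> is not much
  larger than \<open>n\<^sub>s\<close>, so every set of at most \<open>2 t\<close> vertices in the levels up to \<open>s\<close> is 4-colourable:
  three colours before level \<open>s\<close>, and a fourth for level \<open>s\<close>, which is independent. This is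
  \<open>colourable_core\<close>, and it is the source of the constant 4. For a set \<open>W\<close> take \<open>t = |W|\<close>: up to a
  negligible part, \<open>W\<close> is 4-colourable, which bounds the Hall ratio. For a subgraph with edge set \<open>F\<close>
  take \<open>t = |F|\<close>: all but a negligible number of the edges have an endpoint in the levels up to \<open>s\<close>,
  so the degrees of those vertices sum to almost \<open>|F|\<close>, and the heaviest of four colour classes
  receives a quarter of that.
\<close>

section \<open>Elementary estimates\<close>

lemma power_self_le_fact: "real n ^ n \<le> 3 ^ n * fact n"
proof -
  have "real n ^ n / fact n \<le> exp (real n)"
  proof -
    have s: "summable (\<lambda>i. real n ^ i /\<^sub>R fact i)" by (rule summable_exp_generic)
    have "(\<Sum>i\<in>{n}. real n ^ i /\<^sub>R fact i) \<le> (\<Sum>i. real n ^ i /\<^sub>R fact i)"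
      by (rule sum_le_suminf[OF s]) auto
    then show ?thesis by (simp add: exp_def divide_inverse mult.commute)
  qed
  also have "\<dots> = exp 1 ^ n" by (simp flip: exp_of_nat_mult)
  also have "\<dots> \<le> 3 ^ n" using exp_le by (intro power_mono) auto
  finally show ?thesis by (simp add: divide_simps)
qed

lemma binomial_le_quotient_power:
  assumes "0 < x"
  shows "real (n choose x) \<le> (3 * real n / real x) ^ x"
proof -
  have "real (n choose x) * real x ^ x \<le> real (n choose x) * (3 ^ x * fact x)"
    by (intro mult_left_mono power_self_le_fact) auto
  also have "\<dots> = 3 ^ x * real ((n choose x) * fact x)" by simp
  also have "\<dots> \<le> 3 ^ x * real (n ^ x)"
    by (intro mult_left_mono of_nat_mono binomial_fact_pow) auto
  finally show ?thesis using assms by (simp add: power_divide power_mult_distrib field_simps)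
qed

text \<open>
  The independence of the random choices: for a uniformly random function in a product of finite
  sets, the constraints at different arguments multiply.
\<close>

lemma card_box_event:
  fixes B T :: "'a \<Rightarrow> 'b set"
  assumes "finite P" "Q \<subseteq> P" "\<And>p. p \<in> P \<Longrightarrow> finite (B p) \<and> B p \<noteq> {}"
  shows "real (card {f \<in> PiE P B. \<forall>p\<in>Q. f p \<in> T p})
    = real (card (PiE P B)) * (\<Prod>p\<in>Q. real (card (B p \<inter> T p)) / real (card (B p)))"
proof -
  let ?B = "\<lambda>p. if p \<in> Q then B p \<inter> T p else B p"
  have "{f \<in> PiE P B. \<forall>p\<in>Q. f p \<in> T p} = PiE P ?B"
    using assms(2) by (auto simp: PiE_iff extensional_def split: if_splits)
  then have "real (card {f \<in> PiE P B. \<forall>p\<in>Q. f p \<in> T p}) = (\<Prod>p\<in>P. real (card (?B p)))"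
    using assms(1) by (simp add: card_PiE)
  also have "\<dots> = (\<Prod>p\<in>P. real (card (B p)) *
      (if p \<in> Q then real (card (B p \<inter> T p)) / real (card (B p)) else 1))"
    using assms(3) by (intro prod.cong) (auto simp: card_gt_0_iff)
  also have "\<dots> = (\<Prod>p\<in>P. real (card (B p))) *
      (\<Prod>p\<in>P. if p \<in> Q then real (card (B p \<inter> T p)) / real (card (B p)) else 1)"
    by (rule prod.distrib)
  also have "(\<Prod>p\<in>P. if p \<in> Q then real (card (B p \<inter> T p)) / real (card (B p)) else 1)
      = (\<Prod>p\<in>Q. real (card (B p \<inter> T p)) / real (card (B p)))"
    using assms(1,2) by (simp add: prod.inter_restrict[symmetric] Int_absorb1 flip: prod.inter_restrict)
  finally show ?thesis using assms(1) by (simp add: card_PiE)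
qed

lemma real_card_UN_le:
  assumes "finite I" "\<And>i. i \<in> I \<Longrightarrow> real (card (A i)) \<le> c i"
  shows "real (card (\<Union>i\<in>I. A i)) \<le> (\<Sum>i\<in>I. c i)"
proof -
  have "real (card (\<Union>i\<in>I. A i)) \<le> real (\<Sum>i\<in>I. card (A i))"
    using assms(1) by (intro of_nat_mono card_UN_le)
  also have "\<dots> \<le> (\<Sum>i\<in>I. c i)" using assms(2) by (simp add: sum_mono)
  finally show ?thesis .
qed

lemma sum_power_le_twice:
  fixes q :: real
  assumes "0 \<le> q" "q \<le> 1 / 2"
  shows "(\<Sum>x\<in>{1..M}. q ^ x) \<le> 2 * q"
proof -
  have "(\<Sum>x\<in>{1..M}. q ^ x) = q * (\<Sum>x<M. q ^ x)"
    by (simp add: sum_distrib_left sum.atLeast1_atMost_eq flip: power_Suc)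
  also have "\<dots> \<le> q * 2"
  proof (intro mult_left_mono)
    have "(\<Sum>x<M. q ^ x) * (1 / 2) \<le> (\<Sum>x<M. q ^ x) * (1 - q)"
      using assms by (intro mult_left_mono sum_nonneg) auto
    also have "\<dots> \<le> 1" using assms by (simp add: one_diff_power_eq mult.commute flip: one_diff_power_eq)
    finally show "(\<Sum>x<M. q ^ x) \<le> 2" by simp
  qed (rule assms)
  finally show ?thesis by (simp only: mult.commute)
qed

section \<open>Colourings, weights and independent sets\<close>

definition colourable :: "nat \<Rightarrow> 'a set \<Rightarrow> 'a set set \<Rightarrow> bool" where
  "colourable q X E \<longleftrightarrow>
     (\<exists>c :: 'a \<Rightarrow> nat. (\<forall>v\<in>X. c v < q) \<and> (\<forall>i. indep {v \<in> X. c v = i} E))"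

lemma sum_incident_edges:
  assumes "finite Y" "finite F" "\<And>e. e \<in> F \<Longrightarrow> e \<subseteq> Y \<and> card e = 2"
  shows "(\<Sum>v\<in>Y. card {e \<in> F. v \<in> e}) = 2 * card F"
proof -
  have "(\<Sum>v\<in>Y. card {e \<in> F. v \<in> e}) = (\<Sum>e\<in>F. card {v \<in> Y. v \<in> e})"
    using sum.swap_restrict[OF assms(1,2), of "\<lambda>_ _. 1::nat" "\<lambda>v e. v \<in> e"] by simp
  also have "\<dots> = (\<Sum>e\<in>F. 2)"
  proof (rule sum.cong[OF refl])
    fix e assume "e \<in> F"
    then have "{v \<in> Y. v \<in> e} = e" "card e = 2" using assms(3) by auto
    then show "card {v \<in> Y. v \<in> e} = 2" by simp
  qed
  finally show ?thesis by simp
qed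

text \<open>
  Every nonempty \<open>Y \<subseteq> X\<close> has average degree below three, hence a vertex with at most two neighbours
  in \<open>Y\<close>. Removing such a vertex, colouring the rest and putting it back leaves one of three
  colours free.
\<close>

lemma colourable_if_sparse:
  assumes "finite X" "finite E" "\<And>e. e \<in> E \<Longrightarrow> card e = 2"
    and "\<And>Y. Y \<subseteq> X \<Longrightarrow> Y \<noteq> {} \<Longrightarrow> 2 * card {e \<in> E. e \<subseteq> Y} < 3 * card Y"
  shows "colourable 3 X E"
  using assms(1,4)
proof (induction X rule: finite_psubset_induct)
  case (psubset X)
  show ?case
  proof (cases "X = {}")
    case True
    then show ?thesis by (auto simp: colourable_def indep_def)
  next
    case False
    let ?F = "{e \<in> E. e \<subseteq> X}"
    have "\<exists>v\<in>X. card {e \<in> ?F. v \<in> e} \<le> 2"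
    proof (rule ccontr)
      assume "\<not> ?thesis"
      then have "(\<Sum>v\<in>X. 3) \<le> (\<Sum>v\<in>X. card {e \<in> ?F. v \<in> e})" by (intro sum_mono) force
      also have "\<dots> = 2 * card ?F"
        using assms(2,3) psubset(1) by (intro sum_incident_edges) auto
      finally show False using psubset(3)[of X] False by simp
    qed
    then obtain v where v: "v \<in> X" "card {e \<in> ?F. v \<in> e} \<le> 2" by blast
    have "colourable 3 (X - {v}) E"
      using v(1) psubset(3) by (intro psubset(2)) auto
    then obtain c :: "'a \<Rightarrow> nat" where
      c: "\<forall>u\<in>X - {v}. c u < 3" "\<And>i. indep {u \<in> X - {v}. c u = i} E"
      unfolding colourable_def by blast
    let ?N = "{u \<in> X - {v}. {u, v} \<in> E}"
    have "card ((\<lambda>u. {u, v}) ` ?N) \<le> card {e \<in> ?F. v \<in> e}"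
      using v(1) assms(2) by (intro card_mono) auto
    moreover have "card ((\<lambda>u. {u, v}) ` ?N) = card ?N"
      by (intro card_image) (auto simp: inj_on_def doubleton_eq_iff)
    moreover have "card (c ` ?N) \<le> card ?N" using psubset(1) by (intro card_image_le) auto
    ultimately have "card (c ` ?N) < card {..<3::nat}" using v(2) by simp
    then have "\<not> {..<3} \<subseteq> c ` ?N"
      using psubset(1) card_mono[of "c ` ?N" "{..<3}"] by auto
    then obtain d where d: "d < 3" "d \<notin> c ` ?N" by blast
    have "indep {u \<in> X. (c(v := d)) u = i} E" for i
      unfolding indep_def
    proof (intro ballI impI)
      fix x y assume xy: "x \<in> {u \<in> X. (c(v := d)) u = i}" "y \<in> {u \<in> X. (c(v := d)) u = i}" "x \<noteq> y"
      consider "x = v" "y \<noteq> v" | "y = v" "x \<noteq> v" | "x \<noteq> v" "y \<noteq> v" using xy(3) by blast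
      then show "{x, y} \<notin> E"
      proof cases
        case 1
        then show ?thesis using xy d(2) by (auto simp: insert_commute image_iff)
      next
        case 2
        then show ?thesis using xy d(2) by (auto simp: image_iff)
      next
        case 3
        then show ?thesis using xy c(2)[of i] by (auto simp: indep_def)
      qed
    qed
    then show ?thesis
      unfolding colourable_def using c(1) d(1) by (intro exI[of _ "c(v := d)"]) auto
  qed
qed

lemma colourable_heavy_indep_set:
  assumes "finite X" "colourable q X E" "0 < q"
  shows "\<exists>I\<subseteq>X. indep I E \<and> (\<Sum>v\<in>X. w v) / real q \<le> (\<Sum>v\<in>I. w v)"
proof -
  from assms(2) obtain c :: "'a \<Rightarrow> nat" where
    c: "\<forall>v\<in>X. c v < q" "\<And>i. indep {v \<in> X. c v = i} E"
    unfolding colourable_def by blast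
  have eq: "(\<Sum>v\<in>X. w v) = (\<Sum>i<q. \<Sum>v | v \<in> X \<and> c v = i. w v)"
    using c(1) assms(1) by (intro sum.group[symmetric]) auto
  have "\<exists>i<q. (\<Sum>v\<in>X. w v) / real q \<le> (\<Sum>v | v \<in> X \<and> c v = i. w v)"
  proof (rule ccontr)
    assume "\<not> ?thesis"
    then have "(\<Sum>i<q. \<Sum>v | v \<in> X \<and> c v = i. w v) < (\<Sum>i<q. (\<Sum>v\<in>X. w v) / real q)"
      using assms(3) by (intro sum_strict_mono) (auto simp: not_le)
    then show False using assms(3) eq by simp
  qed
  then show ?thesis using c(2) by (metis (no_types, lifting) mem_Collect_eq subsetI)
qed

text \<open>
  Weak linear programming duality: paying \<open>w v\<close> for covering \<open>v\<close>, each independent set earns at most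
  \<open>M\<close> per unit of its fractional weight.
\<close>

lemma fractional_chromatic_number_ge:
  assumes V: "finite V" and w: "\<And>v. v \<in> V \<Longrightarrow> 0 \<le> w v" and M: "0 < M"
    and I: "\<And>I. I \<in> indep_sets V E \<Longrightarrow> (\<Sum>v\<in>I. w v) \<le> M"
  shows "(\<Sum>v\<in>V. w v) / M \<le> fractional_chromatic_number V E"
  unfolding fractional_chromatic_number_def
proof (rule cInf_greatest)
  show "{\<Sum>I\<in>indep_sets V E. x I |x. fractional_colouring V E x} \<noteq> {}"
    using fractional_colouring_exists[OF V] by blast
next
  fix y assume "y \<in> {\<Sum>I\<in>indep_sets V E. x I |x. fractional_colouring V E x}"
  then obtain x where x: "fractional_colouring V E x" and y: "y = (\<Sum>I\<in>indep_sets V E. x I)" by blast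
  have "(\<Sum>v\<in>V. w v) \<le> (\<Sum>v\<in>V. w v * (\<Sum>I | I \<in> indep_sets V E \<and> v \<in> I. x I))"
    using x w by (intro sum_mono mult_le_cancel_left1[THEN iffD2]) (force simp: fractional_colouring_def not_less)
  also have "\<dots> = (\<Sum>v\<in>V. \<Sum>I | I \<in> indep_sets V E \<and> v \<in> I. w v * x I)"
    by (simp add: sum_distrib_left)
  also have "\<dots> = (\<Sum>I\<in>indep_sets V E. \<Sum>v | v \<in> V \<and> v \<in> I. w v * x I)"
    using V by (intro sum.swap_restrict finite_indep_sets)
  also have "\<dots> = (\<Sum>I\<in>indep_sets V E. x I * (\<Sum>v\<in>I. w v))"
  proof (rule sum.cong[OF refl])
    fix I assume "I \<in> indep_sets V E"
    then have "{v. v \<in> V \<and> v \<in> I} = I" by (auto simp: indep_sets_def)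
    then show "(\<Sum>v | v \<in> V \<and> v \<in> I. w v * x I) = x I * (\<Sum>v\<in>I. w v)"
      by (simp add: sum_distrib_left mult.commute)
  qed
  also have "\<dots> \<le> (\<Sum>I\<in>indep_sets V E. x I * M)"
    using x I by (intro sum_mono mult_left_mono) (auto simp: fractional_colouring_def)
  also have "\<dots> = y * M" by (simp add: y sum_distrib_right)
  finally show "(\<Sum>v\<in>V. w v) / M \<le> y" using M by (simp add: divide_simps)
qed

lemma colourable_Suc:
  assumes "colourable q (X - Z) E" "indep Z E"
  shows "colourable (Suc q) X E"
proof -
  from assms(1) obtain c :: "'a \<Rightarrow> nat" where
    c: "\<forall>v\<in>X - Z. c v < q" "\<And>i. indep {v \<in> X - Z. c v = i} E"
    unfolding colourable_def by blast
  let ?c = "\<lambda>v. if v \<in> Z then q else c v"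
  have "indep {v \<in> X. ?c v = i} E" for i
  proof (cases "i = q")
    case True
    then have "{v \<in> X. ?c v = i} \<subseteq> Z" using c(1) by (auto split: if_splits)
    then show ?thesis by (rule smaller_indep[OF assms(2)])
  next
    case False
    then have "{v \<in> X. ?c v = i} \<subseteq> {v \<in> X - Z. c v = i}" by (auto split: if_splits)
    then show ?thesis by (rule smaller_indep[OF c(2)])
  qed
  then show ?thesis
    unfolding colourable_def using c(1) by (intro exI[of _ ?c]) (auto intro: less_SucI)
qed

section \<open>Random graphs on a levelled vertex set\<close>

locale levelled_set =
  fixes V :: "'a set" and lev :: "'a \<Rightarrow> nat" and k :: nat
  assumes finite_V [simp, intro]: "finite V"
    and lev_less: "v \<in> V \<Longrightarrow> lev v < k"
    and level_inhabited: "s < k \<Longrightarrow> \<exists>v\<in>V. lev v = s"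
begin

definition level :: "nat \<Rightarrow> 'a set" where
  "level s = {v \<in> V. lev v = s}"

text \<open>
  A slot \<open>(v, j)\<close> stands for the choice that \<open>v\<close> makes in level \<open>j\<close>. A choice function determines a graph,
  and counting slots instead of edges turns the edge counts below into statements about functions.
\<close>

definition slots :: "('a \<times> nat) set" where
  "slots = {(v, j). v \<in> V \<and> lev v < j \<and> j < k}"

definition choices :: "('a \<times> nat \<Rightarrow> 'a) set" where
  "choices = PiE slots (\<lambda>p. level (snd p))"

definition edges :: "('a \<times> nat \<Rightarrow> 'a) \<Rightarrow> 'a set set" where
  "edges f = (\<lambda>p. {fst p, f p}) ` slots"

definition inner_slots :: "('a \<times> nat \<Rightarrow> 'a) \<Rightarrow> 'a set \<Rightarrow> ('a \<times> nat) set" where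
  "inner_slots f X = {p \<in> slots. fst p \<in> X \<and> f p \<in> X}"

lemma finite_level [simp, intro]: "finite (level s)"
  by (simp add: level_def)

lemma level_subset: "level s \<subseteq> V"
  by (auto simp: level_def)

lemma level_nonempty: "s < k \<Longrightarrow> level s \<noteq> {}"
  using level_inhabited by (auto simp: level_def)

lemma card_level_pos: "s < k \<Longrightarrow> 0 < card (level s)"
  using level_nonempty by (simp add: card_gt_0_iff)

lemma finite_slots [simp, intro]: "finite slots"
  by (rule finite_subset[of _ "V \<times> {..<k}"]) (auto simp: slots_def)

lemma finite_choices [simp, intro]: "finite choices"
  unfolding choices_def by (intro finite_PiE) auto

lemma card_choices_pos: "0 < card choices"
proof -
  have "choices \<noteq> {}"
    unfolding choices_def using level_nonempty by (auto simp: PiE_eq_empty_iff slots_def)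
  then show ?thesis by (simp add: card_gt_0_iff)
qed

lemma choice_in_level: "f \<in> choices \<Longrightarrow> p \<in> slots \<Longrightarrow> f p \<in> level (snd p)"
  by (auto simp: choices_def)

lemma finite_edges [simp, intro]: "finite (edges f)"
  by (simp add: edges_def)

lemma edges_subset:
  assumes "f \<in> choices"
  shows "edges f \<subseteq> [V]\<^bsup>2\<^esup>"
proof -
  have "fst p \<in> V" "f p \<in> V" "fst p \<noteq> f p" if "p \<in> slots" for p
    using choice_in_level[OF assms that] that by (auto simp: slots_def level_def)
  then show ?thesis by (auto simp: edges_def nsets_def)
qed

lemma card_edges_le_inner_slots: "card {e \<in> edges f. e \<subseteq> X} \<le> card (inner_slots f X)"
proof -
  have "{e \<in> edges f. e \<subseteq> X} \<subseteq> (\<lambda>p. {fst p, f p}) ` inner_slots f X"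
    by (auto simp: edges_def inner_slots_def)
  then have "card {e \<in> edges f. e \<subseteq> X} \<le> card ((\<lambda>p. {fst p, f p}) ` inner_slots f X)"
    by (intro card_mono) (auto simp: inner_slots_def)
  also have "\<dots> \<le> card (inner_slots f X)"
    by (intro card_image_le) (auto simp: inner_slots_def)
  finally show ?thesis .
qed

lemma indep_level:
  assumes "f \<in> choices"
  shows "indep (level s) (edges f)"
  unfolding indep_def
proof (intro ballI impI notI)
  fix x y assume "x \<in> level s" "y \<in> level s" "x \<noteq> y" "{x, y} \<in> edges f"
  then obtain p where "p \<in> slots" "{x, y} = {fst p, f p}" by (auto simp: edges_def)
  then show False
    using choice_in_level[OF assms \<open>p \<in> slots\<close>] \<open>x \<in> level s\<close> \<open>y \<in> level s\<close>
    by (auto simp: slots_def level_def doubleton_eq_iff)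
qed

lemma card_choices_event:
  assumes "Q \<subseteq> slots"
  shows "real (card {f \<in> choices. \<forall>p\<in>Q. f p \<in> T p}) = real (card choices) *
    (\<Prod>p\<in>Q. real (card (level (snd p) \<inter> T p)) / real (card (level (snd p))))"
  unfolding choices_def using assms level_nonempty
  by (intro card_box_event finite_slots) (auto simp: slots_def)

section \<open>Two families of unlikely events\<close>

text \<open>
  The first moment bound for dense sets of size \<open>x\<close>. There are at most \<open>(3 n / x)\<^sup>x\<close> such sets \<open>X\<close>
  and at most \<open>2\<^bsup>k x\<^esup>\<close> sets of slots at \<open>X\<close>. Each given slot is filled from \<open>X\<close> with probability at
  most \<open>x / m\<close>, and at least \<open>3 x / 2\<close> of them have to be. What makes the product small is that the
  exponent \<open>3 / 2\<close> exceeds one: a spare factor of the square root of \<open>x / m\<close> remains for each vertex.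
\<close>

lemma card_dense_event:
  fixes m :: real
  assumes X: "0 < x" and m: "\<And>j. j < s \<Longrightarrow> m \<le> real (card (level j))" "0 < m"
    and xm: "real x \<le> m"
  shows "real (card {f \<in> choices. \<exists>X. X \<subseteq> {v \<in> V. lev v < s} \<and> card X = x \<and>
      3 * x \<le> 2 * card (inner_slots f X)})
    \<le> real (card choices) *
       (3 * 2 ^ k * (real (card V) / m) * sqrt (real x / m)) ^ x"
proof -
  \<comment> \<open>Working with \<open>y\<close>, where \<open>y\<^sup>2 = x / m\<close>, avoids rounding \<open>3 x / 2\<close>.\<close>
  define y where "y = sqrt (real x / m)"
  have y: "0 \<le> y" "y \<le> 1" "y ^ 2 = real x / m" using xm m(2) by (auto simp: y_def)
  define Xs where "Xs = {X. X \<subseteq> V \<and> card X = x}"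
  define Qs where "Qs X = {Q. Q \<subseteq> X \<times> {..<s} \<and> Q \<subseteq> slots \<and> 3 * x \<le> 2 * card Q}" for X
  define ev where "ev X Q = {f \<in> choices. \<forall>p\<in>Q. f p \<in> X}" for X Q
  have fX: "finite X" if "X \<in> Xs" for X using that finite_subset by (auto simp: Xs_def)
  have finQ: "finite (Qs X)" for X
    by (rule finite_subset[of _ "Pow slots"]) (auto simp: Qs_def)
  have ev_bound: "real (card (ev X Q)) \<le> real (card choices) * y ^ (3 * x)"
    if "X \<in> Xs" "Q \<in> Qs X" for X Q
  proof -
    have Q: "Q \<subseteq> slots" "Q \<subseteq> X \<times> {..<s}" "3 * x \<le> 2 * card Q" using that by (auto simp: Qs_def)
    have "real (card (ev X Q)) = real (card choices) *
        (\<Prod>p\<in>Q. real (card (level (snd p) \<inter> X)) / real (card (level (snd p))))"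
      unfolding ev_def by (rule card_choices_event[OF Q(1)])
    also have "\<dots> \<le> real (card choices) * (\<Prod>p\<in>Q. y ^ 2)"
    proof (intro mult_left_mono prod_mono conjI)
      fix p assume "p \<in> Q"
      then have "snd p < s" using Q(2) by auto
      have "card (level (snd p) \<inter> X) \<le> x"
        using that(1) card_mono[OF fX[OF that(1)], of "level (snd p) \<inter> X"] by (simp add: Xs_def)
      then show "real (card (level (snd p) \<inter> X)) / real (card (level (snd p))) \<le> y ^ 2"
        unfolding y(3) using m(1)[OF \<open>snd p < s\<close>] m(2) by (intro frac_le) auto
    qed auto
    also have "(\<Prod>p\<in>Q. y ^ 2) = y ^ (2 * card Q)" by (simp add: power_mult)
    also have "\<dots> \<le> y ^ (3 * x)" using y Q(3) by (intro power_decreasing) auto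
    finally show ?thesis by (simp add: mult_left_mono)
  qed
  have cardQ: "real (card (Qs X)) \<le> (2 ^ k) ^ x" if "X \<in> Xs" for X
  proof (cases "Qs X = {}")
    case False
    have "Qs X \<subseteq> Pow (slots \<inter> X \<times> {..<k})" by (auto simp: Qs_def slots_def)
    then have "card (Qs X) \<le> card (Pow (slots \<inter> X \<times> {..<k}))"
      using fX[OF that] by (intro card_mono) auto
    also have "\<dots> = 2 ^ card (slots \<inter> X \<times> {..<k})" using fX[OF that] by (intro card_Pow) auto
    also have "\<dots> \<le> 2 ^ card (X \<times> {..<k})"
      using fX[OF that] by (intro power_increasing card_mono) auto
    also have "\<dots> = (2 ^ k) ^ x"
      using that by (simp add: card_cartesian_product Xs_def mult.commute flip: power_mult)
    finally show ?thesis by (metis of_nat_le_iff of_nat_numeral of_nat_power)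
  qed simp
  have "{f \<in> choices. \<exists>X. X \<subseteq> {v \<in> V. lev v < s} \<and> card X = x \<and>
      3 * x \<le> 2 * card (inner_slots f X)} \<subseteq> (\<Union>X\<in>Xs. \<Union>Q\<in>Qs X. ev X Q)"
  proof (safe)
    fix f X assume f: "f \<in> choices" "X \<subseteq> {v \<in> V. lev v < s}" "x = card X"
      and d: "3 * card X \<le> 2 * card (inner_slots f X)"
    have "snd p < s" if "p \<in> inner_slots f X" for p
      using that f(2) choice_in_level[OF f(1), of p] by (auto simp: inner_slots_def level_def)
    then have "inner_slots f X \<in> Qs X"
      using d f(3) by (auto simp: Qs_def inner_slots_def)
    moreover have "f \<in> ev X (inner_slots f X)" using f(1) by (auto simp: ev_def inner_slots_def)
    moreover have "X \<in> Xs" using f by (auto simp: Xs_def)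
    ultimately show "f \<in> (\<Union>X\<in>Xs. \<Union>Q\<in>Qs X. ev X Q)" by blast
  qed
  then have "card {f \<in> choices. \<exists>X. X \<subseteq> {v \<in> V. lev v < s} \<and> card X = x \<and>
      3 * x \<le> 2 * card (inner_slots f X)} \<le> card (\<Union>X\<in>Xs. \<Union>Q\<in>Qs X. ev X Q)"
    using finQ by (intro card_mono) (auto simp: Xs_def ev_def)
  then have "real (card {f \<in> choices. \<exists>X. X \<subseteq> {v \<in> V. lev v < s} \<and> card X = x \<and>
      3 * x \<le> 2 * card (inner_slots f X)}) \<le> real (card (\<Union>X\<in>Xs. \<Union>Q\<in>Qs X. ev X Q))" by simp
  also have "\<dots> \<le> (\<Sum>X\<in>Xs. (2 ^ k) ^ x * (real (card choices) * y ^ (3 * x)))"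
  proof (rule real_card_UN_le)
    fix X assume X: "X \<in> Xs"
    have "real (card (\<Union>Q\<in>Qs X. ev X Q)) \<le> (\<Sum>Q\<in>Qs X. real (card choices) * y ^ (3 * x))"
      using X by (intro real_card_UN_le ev_bound finQ)
    also have "\<dots> \<le> (2 ^ k) ^ x * (real (card choices) * y ^ (3 * x))"
      using cardQ[OF X] y by (simp add: mult_right_mono)
    finally show "real (card (\<Union>Q\<in>Qs X. ev X Q)) \<le> (2 ^ k) ^ x * (real (card choices) * y ^ (3 * x))" .
  qed (auto simp: Xs_def)
  also have "\<dots> = real (card V choose x) * ((2 ^ k) ^ x * (real (card choices) * y ^ (3 * x)))"
    by (simp add: Xs_def n_subsets)
  also have "\<dots> \<le> (3 * real (card V) / real x) ^ x * ((2 ^ k) ^ x * (real (card choices) * y ^ (3 * x)))"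
    using y X by (intro mult_right_mono binomial_le_quotient_power) auto
  also have "\<dots> = real (card choices) * (3 * real (card V) / real x * 2 ^ k * y ^ 3) ^ x"
    unfolding power_mult power_mult_distrib by (simp only: mult_ac)
  also have "3 * real (card V) / real x * 2 ^ k * y ^ 3 = 3 * 2 ^ k * (real (card V) / m) * y"
    using X m(2) y(3) by (simp add: power3_eq_cube power2_eq_square field_simps)
  finally show ?thesis by (simp add: y_def)
qed

text \<open>
  Here \<open>A\<close> is a part of level \<open>i\<close> and \<open>J\<close> a set in the later levels with no edges between them. A single
  vertex misses \<open>J\<close> with probability at most \<open>1 / (12 k)\<close>. The binomial coefficient leaves at most
  \<open>(3 k)\<^sup>a\<close> candidates for \<open>A\<close>, and there are at most \<open>2\<^sup>a\<close> candidates for \<open>J\<close> because the later levels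
  are small; the constant 12 is chosen so that \<open>2 \<cdot> 3 k / (12 k) = 1 / 2\<close>.
\<close>

lemma card_bare_event:
  assumes k: "0 < k" and a: "real (card (level i)) \<le> real k * real a" "0 < a"
    and tail: "card {v \<in> V. i < lev v} \<le> a"
  shows "real (card {f \<in> choices. \<exists>A J. A \<subseteq> level i \<and> card A = a \<and> J \<subseteq> {v \<in> V. i < lev v} \<and>
      ln (12 * real k) \<le> (\<Sum>j\<in>{i<..<k}. real (card (level j \<inter> J)) / real (card (level j))) \<and>
      (\<forall>v\<in>A. \<forall>j\<in>{i<..<k}. f (v, j) \<notin> J)})
    \<le> real (card choices) * (1 / 2) ^ a"
proof -
  define As where "As = {A. A \<subseteq> level i \<and> card A = a}"
  define x where "x J j = real (card (level j \<inter> J)) / real (card (level j))" for J j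
  define Js where "Js = {J. J \<subseteq> {v \<in> V. i < lev v} \<and> ln (12 * real k) \<le> (\<Sum>j\<in>{i<..<k}. x J j)}"
  define ev where "ev A J = {f \<in> choices. \<forall>p\<in>A \<times> {i<..<k}. f p \<in> - J}" for A J
  have finJ: "finite Js" by (rule finite_subset[of _ "Pow V"]) (auto simp: Js_def)
  have fA: "finite A" if "A \<in> As" for A using that finite_subset by (auto simp: As_def)
  have ev_bound: "real (card (ev A J)) \<le> real (card choices) * (1 / (12 * real k)) ^ a"
    if "A \<in> As" "J \<in> Js" for A J
  proof -
    have "A \<times> {i<..<k} \<subseteq> slots" using that(1) by (auto simp: As_def slots_def level_def)
    then have "real (card (ev A J)) = real (card choices) *
        (\<Prod>p\<in>A \<times> {i<..<k}. real (card (level (snd p) \<inter> - J)) / real (card (level (snd p))))"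
      unfolding ev_def by (rule card_choices_event)
    also have "\<dots> = real (card choices) * (\<Prod>p\<in>A \<times> {i<..<k}. 1 - x J (snd p))"
    proof (intro arg_cong2[of _ _ _ _ "(*)"] prod.cong refl)
      fix p assume "p \<in> A \<times> {i<..<k}"
      then have "level (snd p) \<noteq> {}" by (auto intro!: level_nonempty)
      moreover have "card (level (snd p) \<inter> - J) = card (level (snd p)) - card (level (snd p) \<inter> J)"
        using card_Diff_subset_Int[of "level (snd p)" J] by (simp add: Diff_eq)
      moreover have "card (level (snd p) \<inter> J) \<le> card (level (snd p))" by (intro card_mono) auto
      ultimately show "real (card (level (snd p) \<inter> - J)) / real (card (level (snd p))) = 1 - x J (snd p)"
        by (simp add: x_def of_nat_diff diff_divide_distrib)
    qed
    also have "(\<Prod>p\<in>A \<times> {i<..<k}. 1 - x J (snd p)) = (\<Prod>j\<in>{i<..<k}. 1 - x J j) ^ a"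
      using that(1) prod.cartesian_product[of "\<lambda>v j. 1 - x J j" "{i<..<k}" A]
      by (simp add: As_def case_prod_unfold)
    also have "\<dots> \<le> (1 / (12 * real k)) ^ a"
    proof (intro power_mono)
      have x1: "x J j \<le> 1" for j
      proof -
        have "card (level j \<inter> J) \<le> card (level j)" by (intro card_mono) auto
        then show ?thesis unfolding x_def by (intro divide_le_eq_1[THEN iffD2]) linarith
      qed
      have "(\<Prod>j\<in>{i<..<k}. 1 - x J j) \<le> (\<Prod>j\<in>{i<..<k}. exp (- x J j))"
        using x1 exp_ge_add_one_self[of "- x J j" for j] by (intro prod_mono) auto
      also have "\<dots> = exp (- (\<Sum>j\<in>{i<..<k}. x J j))" by (simp add: exp_sum sum_negf[symmetric])
      also have "\<dots> \<le> exp (- ln (12 * real k))" using that(2) by (simp add: Js_def)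
      also have "\<dots> = 1 / (12 * real k)" using k by (simp only: exp_minus exp_ln inverse_eq_divide)
      finally show "(\<Prod>j\<in>{i<..<k}. 1 - x J j) \<le> 1 / (12 * real k)" .
      show "0 \<le> (\<Prod>j\<in>{i<..<k}. 1 - x J j)" using x1 by (intro prod_nonneg) auto
    qed
    finally show ?thesis by (simp add: mult_left_mono)
  qed
  have cardJ: "real (card Js) \<le> 2 ^ a"
  proof -
    have "card Js \<le> card (Pow {v \<in> V. i < lev v})" by (intro card_mono) (auto simp: Js_def)
    also have "\<dots> = 2 ^ card {v \<in> V. i < lev v}" by (simp add: card_Pow)
    also have "\<dots> \<le> 2 ^ a" using tail by (intro power_increasing) auto
    finally show ?thesis by (metis of_nat_le_iff of_nat_numeral of_nat_power)
  qed
  have cardA: "real (card As) \<le> (3 * real k) ^ a"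
  proof -
    have "real (card As) = real (card (level i) choose a)" by (simp add: As_def n_subsets)
    also have "\<dots> \<le> (3 * real (card (level i)) / real a) ^ a"
      using a(2) by (rule binomial_le_quotient_power)
    also have "\<dots> \<le> (3 * real k) ^ a"
      using a by (intro power_mono) (auto simp: divide_le_eq)
    finally show ?thesis .
  qed
  have "{f \<in> choices. \<exists>A J. A \<subseteq> level i \<and> card A = a \<and> J \<subseteq> {v \<in> V. i < lev v} \<and>
      ln (12 * real k) \<le> (\<Sum>j\<in>{i<..<k}. real (card (level j \<inter> J)) / real (card (level j))) \<and>
      (\<forall>v\<in>A. \<forall>j\<in>{i<..<k}. f (v, j) \<notin> J)} \<subseteq> (\<Union>A\<in>As. \<Union>J\<in>Js. ev A J)"
    by (auto simp: As_def Js_def ev_def x_def)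
  then have "card {f \<in> choices. \<exists>A J. A \<subseteq> level i \<and> card A = a \<and> J \<subseteq> {v \<in> V. i < lev v} \<and>
      ln (12 * real k) \<le> (\<Sum>j\<in>{i<..<k}. real (card (level j \<inter> J)) / real (card (level j))) \<and>
      (\<forall>v\<in>A. \<forall>j\<in>{i<..<k}. f (v, j) \<notin> J)} \<le> card (\<Union>A\<in>As. \<Union>J\<in>Js. ev A J)" (is "?L \<le> _")
    using finJ by (intro card_mono) (auto simp: As_def ev_def)
  then have "real ?L \<le> real (card (\<Union>A\<in>As. \<Union>J\<in>Js. ev A J))" by simp
  also have "\<dots> \<le> (\<Sum>A\<in>As. \<Sum>J\<in>Js. real (card choices) * (1 / (12 * real k)) ^ a)"
    using finJ by (intro real_card_UN_le ev_bound) (auto simp: As_def)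
  also have "\<dots> = real (card As) * real (card Js) * (real (card choices) * (1 / (12 * real k)) ^ a)"
    by simp
  also have "\<dots> \<le> (3 * real k) ^ a * 2 ^ a * (real (card choices) * (1 / (12 * real k)) ^ a)"
    using cardA cardJ by (intro mult_right_mono mult_mono) auto
  also have "\<dots> = real (card choices) * (3 * real k * 2 * (1 / (12 * real k))) ^ a"
    by (simp only: power_mult_distrib mult_ac)
  also have "3 * real k * 2 * (1 / (12 * real k)) = 1 / 2" using k by simp
  finally show ?thesis .
qed

end

section \<open>Rapidly shrinking levels\<close>

text \<open>
  With \<open>D\<^sub>s = n / n\<^sub>s\<close> the condition reads \<open>D\<^sub>s\<^sub>+\<^sub>1 \<ge> 576 \<cdot> 2\<^bsup>6 k\<^esup> \<cdot> D\<^sub>s\<^sup>3\<close>. The cube comes from the first moment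
  computation: for \<open>x \<le> 4\<^sup>k n\<^sub>s\<^sub>+\<^sub>1\<close> and \<open>m = n\<^sub>s\<close> it makes the base of the power in \<open>card_dense_event\<close> at
  most \<open>1 / (8 \<cdot> 2\<^sup>k)\<close>, which is small enough to sum over all sizes \<open>x\<close> and all levels.
\<close>

locale shrinking_levels = levelled_set +
  assumes k_pos: "0 < k"
    and shrink: "Suc s < k \<Longrightarrow>
      576 * (2 ^ k) ^ 6 * card V ^ 2 * card (level (Suc s)) \<le> card (level s) ^ 3"
begin

lemma card_V_pos: "0 < card V"
  using card_level_pos[OF k_pos] card_mono[OF finite_V level_subset[of 0]] by linarith

lemma level_ratio:
  assumes "Suc s < k"
  shows "576 * (2 ^ k) ^ 6 * card (level (Suc s)) \<le> card (level s)"
proof -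
  have "card V ^ 2 * (576 * (2 ^ k) ^ 6 * card (level (Suc s))) \<le> card (level s) ^ 2 * card (level s)"
    using shrink[OF assms] by (simp add: power3_eq_cube power2_eq_square mult_ac)
  also have "\<dots> \<le> card V ^ 2 * card (level s)"
    by (intro mult_right_mono power_mono card_mono level_subset) auto
  finally show ?thesis using card_V_pos by simp
qed

lemma card_level_antimono:
  assumes "j \<le> s" "s < k"
  shows "card (level s) \<le> card (level j)"
  using assms
proof (induction s rule: dec_induct)
  case (step s)
  have "card (level (Suc s)) \<le> 576 * (2 ^ k) ^ 6 * card (level (Suc s))" by simp
  then show ?case using level_ratio[of s] step by linarith
qed simp

lemma card_upper_levels:
  assumes "s < k"
  shows "card {v \<in> V. s \<le> lev v} \<le> 2 * card (level s)"
  using assms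
proof (induction "k - s" arbitrary: s)
  case (Suc d)
  have "{v \<in> V. s \<le> lev v} = level s \<union> {v \<in> V. Suc s \<le> lev v}"
    by (auto simp: level_def)
  then have le: "card {v \<in> V. s \<le> lev v} \<le> card (level s) + card {v \<in> V. Suc s \<le> lev v}"
    by (simp add: card_Un_le)
  show ?case
  proof (cases "Suc s < k")
    case True
    have "2 * 1 * card (level (Suc s)) \<le> 576 * (2 ^ k) ^ 6 * card (level (Suc s))"
      by (intro mult_le_mono) auto
    moreover have "card {v \<in> V. Suc s \<le> lev v} \<le> 2 * card (level (Suc s))"
      using Suc(2) True Suc(1)[of "Suc s"] by auto
    ultimately show ?thesis using le level_ratio[OF True] by linarith
  next
    case False
    then have "{v \<in> V. Suc s \<le> lev v} = {}" using lev_less by force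
    then show ?thesis using le by (simp only: card.empty)
  qed
qed simp

text \<open>
  For every fixed \<open>\<epsilon>\<close> the factor \<open>4\<^sup>k\<close> exceeds \<open>4 k / \<epsilon>\<close> once \<open>k\<close> is large, so that one property
  serves all \<open>\<epsilon>\<close>.
\<close>

definition sparse :: "('a \<times> nat \<Rightarrow> 'a) \<Rightarrow> bool" where
  "sparse f \<longleftrightarrow> (\<forall>s X. Suc s < k \<longrightarrow> X \<subseteq> {v \<in> V. lev v < Suc s} \<longrightarrow> X \<noteq> {} \<longrightarrow>
     card X \<le> (2 ^ k) ^ 2 * card (level (Suc s)) \<longrightarrow> 2 * card (inner_slots f X) < 3 * card X)"

text \<open>
  The size of \<open>A\<close> is the least integer exceeding \<open>n\<^sub>i / k\<close>, so that an independent set that contains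
  no such \<open>A\<close> occupies at most the fraction \<open>1 / k\<close> of level \<open>i\<close>.
\<close>

definition expanding :: "('a \<times> nat \<Rightarrow> 'a) \<Rightarrow> bool" where
  "expanding f \<longleftrightarrow> (\<forall>i A J. Suc i < k \<longrightarrow> A \<subseteq> level i \<longrightarrow> J \<subseteq> {v \<in> V. i < lev v} \<longrightarrow>
     card A = Suc (card (level i) div k) \<longrightarrow>
     ln (12 * real k) \<le> (\<Sum>j\<in>{i<..<k}. real (card (level j \<inter> J)) / real (card (level j))) \<longrightarrow>
     (\<exists>v\<in>A. \<exists>j\<in>{i<..<k}. f (v, j) \<in> J))"

lemma card_not_sparse:
  "real (card {f \<in> choices. \<not> sparse f}) \<le> real (card choices) / 4"
proof -
  define bad where "bad s x = {f \<in> choices. \<exists>X. X \<subseteq> {v \<in> V. lev v < Suc s} \<and> card X = x \<and>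
      3 * x \<le> 2 * card (inner_slots f X)}" for s x
  let ?K = "2 ^ k :: real" and ?M = "\<lambda>s. (2 ^ k) ^ 2 * card (level (Suc s))"
  have bound: "real (card (bad s x)) \<le> real (card choices) * (1 / (8 * ?K)) ^ x"
    if s: "s < k - 1" and x: "x \<in> {1..?M s}" for s x
  proof -
    have s': "Suc s < k" using s by simp
    define m where "m = real (card (level s))"
    have m: "0 < m" using card_level_pos[of s] s' by (simp add: m_def)
    have xM: "real x \<le> ?K ^ 2 * real (card (level (Suc s)))"
      using x by (metis (no_types, lifting) atLeastAtMost_iff of_nat_le_iff of_nat_mult of_nat_numeral of_nat_power)
    have V: "0 < real (card V)" using card_V_pos by simp
    have sh: "576 * ?K ^ 6 * real (card V) ^ 2 * real (card (level (Suc s))) \<le> m ^ 3"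
      using of_nat_mono[OF shrink[OF s'], where 'a=real] by (simp add: m_def)
    have "?K ^ 2 * real (card (level (Suc s))) \<le> 576 * ?K ^ 6 * real (card (level (Suc s)))"
    proof (intro mult_right_mono)
      have "?K ^ 2 \<le> ?K ^ 6" by (intro power_increasing) auto
      also have "\<dots> \<le> 576 * ?K ^ 6" by simp
      finally show "?K ^ 2 \<le> 576 * ?K ^ 6" .
    qed simp
    also have "\<dots> \<le> m" using of_nat_mono[OF level_ratio[OF s'], where 'a=real] by (simp add: m_def)
    finally have xm: "real x \<le> m" using xM by simp
    have "real (card (bad s x)) \<le> real (card choices) *
        (3 * 2 ^ k * (real (card V) / m) * sqrt (real x / m)) ^ x"
      unfolding bad_def
    proof (rule card_dense_event)
      show "m \<le> real (card (level j))" if "j < Suc s" for j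
        using that s' card_level_antimono[of j s] by (simp add: m_def)
    qed (use x m xm in auto)
    also have "\<dots> \<le> real (card choices) * (1 / (8 * ?K)) ^ x"
    proof (intro mult_left_mono power_mono)
      have "sqrt (real x / m) \<le> m / (24 * ?K ^ 2 * real (card V))"
      proof (rule real_le_lsqrt)
        have "576 * ?K ^ 4 * real (card V) ^ 2 * real x
            \<le> 576 * ?K ^ 4 * real (card V) ^ 2 * (?K ^ 2 * real (card (level (Suc s))))"
          by (intro mult_left_mono xM) auto
        also have "\<dots> = 576 * (?K ^ 4 * ?K ^ 2) * real (card V) ^ 2 * real (card (level (Suc s)))"
          by (simp only: mult_ac)
        also have "?K ^ 4 * ?K ^ 2 = ?K ^ 6" by (simp flip: power_add)
        finally have "576 * ?K ^ 4 * real (card V) ^ 2 * real x \<le> m ^ 3" using sh by linarith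
        moreover have "0 < 576 * ?K ^ 4 * real (card V) ^ 2" using V by (intro mult_pos_pos zero_less_power) auto
        moreover have "real x / m \<le> m ^ 2 / Z" if "Z * real x \<le> m ^ 3" "0 < Z" for Z
          using that m by (simp add: divide_simps power3_eq_cube power2_eq_square mult_ac)
        moreover have "(m / (24 * ?K ^ 2 * real (card V))) ^ 2
            = m ^ 2 / (576 * ?K ^ 4 * real (card V) ^ 2)"
          by (simp add: power_divide power_mult_distrib flip: power_mult)
        ultimately show "real x / m \<le> (m / (24 * ?K ^ 2 * real (card V))) ^ 2"
          by (simp only:)
      qed (use m in auto)
      then have "3 * ?K * (real (card V) / m) * sqrt (real x / m)
          \<le> 3 * ?K * (real (card V) / m) * (m / (24 * ?K ^ 2 * real (card V)))"
        using m by (intro mult_left_mono) auto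
      also have "\<dots> = 1 / (8 * ?K)" using m V by (auto simp: field_simps power2_eq_square)
      finally show "3 * ?K * (real (card V) / m) * sqrt (real x / m) \<le> 1 / (8 * ?K)" .
    qed (use m in auto)
    finally show ?thesis .
  qed
  have "{f \<in> choices. \<not> sparse f} \<subseteq> (\<Union>s\<in>{..<k - 1}. \<Union>x\<in>{1..?M s}. bad s x)"
  proof
    fix f assume "f \<in> {f \<in> choices. \<not> sparse f}"
    then obtain s X where f: "f \<in> choices" "Suc s < k" "X \<subseteq> {v \<in> V. lev v < Suc s}" "X \<noteq> {}"
      "card X \<le> ?M s" "3 * card X \<le> 2 * card (inner_slots f X)"
      by (auto simp: sparse_def not_less)
    have "finite X" using f(3) by (rule finite_subset) simp
    then have "card X \<in> {1..?M s}" using f(4,5) by (simp add: Suc_le_eq card_gt_0_iff)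
    moreover have "f \<in> bad s (card X)" using f by (auto simp: bad_def)
    ultimately show "f \<in> (\<Union>s\<in>{..<k - 1}. \<Union>x\<in>{1..?M s}. bad s x)"
      using f(2) by (intro UN_I[of s] UN_I[of "card X"]) auto
  qed
  then have "card {f \<in> choices. \<not> sparse f} \<le> card (\<Union>s\<in>{..<k - 1}. \<Union>x\<in>{1..?M s}. bad s x)"
    by (intro card_mono) (auto simp: bad_def)
  then have "real (card {f \<in> choices. \<not> sparse f})
      \<le> real (card (\<Union>s\<in>{..<k - 1}. \<Union>x\<in>{1..?M s}. bad s x))" by simp
  also have "\<dots> \<le> (\<Sum>s\<in>{..<k - 1}. real (card choices) * (2 * (1 / (8 * ?K))))"
  proof (intro real_card_UN_le)
    fix s assume s: "s \<in> {..<k - 1}"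
    have "real (card (\<Union>x\<in>{1..?M s}. bad s x))
        \<le> (\<Sum>x\<in>{1..?M s}. real (card choices) * (1 / (8 * ?K)) ^ x)"
      using s by (intro real_card_UN_le bound) auto
    also have "\<dots> = real (card choices) * (\<Sum>x\<in>{1..?M s}. (1 / (8 * ?K)) ^ x)"
      by (rule sum_distrib_left[symmetric])
    also have "\<dots> \<le> real (card choices) * (2 * (1 / (8 * ?K)))"
    proof (intro mult_left_mono sum_power_le_twice)
      have "2 \<le> 8 * ?K" using one_le_power[of "2 :: real" k] by linarith
      then show "1 / (8 * ?K) \<le> 1 / 2" by (rule divide_left_mono) auto
    qed auto
    finally show "real (card (\<Union>x\<in>{1..?M s}. bad s x)) \<le> real (card choices) * (2 * (1 / (8 * ?K)))" .
  qed simp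
  also have "\<dots> = real (card choices) / 4 * (real (k - 1) / ?K)" by simp
  also have "\<dots> \<le> real (card choices) / 4 * 1"
  proof (intro mult_left_mono)
    have "k - 1 < 2 ^ k" using less_exp[of k] by linarith
    then have "real (k - 1) \<le> ?K" by (metis less_imp_le of_nat_le_iff of_nat_numeral of_nat_power)
    then show "real (k - 1) / ?K \<le> 1" by simp
  qed simp
  finally show ?thesis by simp
qed

lemma card_not_expanding:
  "real (card {f \<in> choices. \<not> expanding f}) \<le> real (card choices) / 4"
proof -
  define a where "a i = Suc (card (level i) div k)" for i
  define bad where "bad i = {f \<in> choices. \<exists>A J. A \<subseteq> level i \<and> card A = a i \<and>
      J \<subseteq> {v \<in> V. i < lev v} \<and>
      ln (12 * real k) \<le> (\<Sum>j\<in>{i<..<k}. real (card (level j \<inter> J)) / real (card (level j))) \<and>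
      (\<forall>v\<in>A. \<forall>j\<in>{i<..<k}. f (v, j) \<notin> J)}" for i
  let ?K = "2 ^ k :: nat"
  have kK: "k < ?K" by (rule less_exp)
  have bound: "real (card (bad i)) \<le> real (card choices) * (1 / (4 * 2 ^ k))"
    if "i < k - 1" for i
  proof -
    have i: "Suc i < k" using that by simp
    have K6: "?K * ?K \<le> ?K ^ 6"
      using power_increasing[of 2 6 ?K] by (simp add: power2_eq_square)
    have "k * (k + 2 * card (level (Suc i)) + 2) \<le> 576 * ?K ^ 6 * card (level (Suc i))"
    proof -
      let ?c = "card (level (Suc i))"
      have c: "1 \<le> ?c" using card_level_pos[OF i] by simp
      have "k + 2 * ?c + 2 \<le> ?K * ?c + 2 * (?K * ?c) + 2 * (?K * ?c)"
      proof (intro add_mono)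
        show "k \<le> ?K * ?c" using kK c mult_le_mono[of k ?K 1 ?c] by simp
        show "2 \<le> 2 * (?K * ?c)" using c by simp
      qed simp
      then have "k * (k + 2 * ?c + 2) \<le> ?K * (5 * (?K * ?c))"
        using kK by (intro mult_le_mono) auto
      also have "\<dots> = 5 * (?K * ?K) * ?c" by simp
      also have "\<dots> \<le> 576 * ?K ^ 6 * ?c" using K6 by (intro mult_le_mono) auto
      finally show ?thesis .
    qed
    then have "k * (k + 2 * card (level (Suc i)) + 2) \<le> card (level i)"
      using level_ratio[OF i] by linarith
    then have large: "k + 2 * card (level (Suc i)) + 2 \<le> card (level i) div k"
      using k_pos by (simp add: less_eq_div_iff_mult_less_eq mult.commute)
    have "real (card (bad i)) \<le> real (card choices) * (1 / 2) ^ a i"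
      unfolding bad_def
    proof (rule card_bare_event)
      have "card (level i) \<le> k * a i"
        using k_pos dividend_less_times_div[of k "card (level i)"] by (simp add: a_def)
      then show "real (card (level i)) \<le> real k * real (a i)"
        by (metis of_nat_le_iff of_nat_mult)
      have "{v \<in> V. i < lev v} = {v \<in> V. Suc i \<le> lev v}" by auto
      then show "card {v \<in> V. i < lev v} \<le> a i"
        using card_upper_levels[OF i] large by (simp add: a_def)
    qed (use k_pos in \<open>auto simp: a_def\<close>)
    also have "(1 / 2 :: real) ^ a i \<le> (1 / 2) ^ (k + 2)"
      using large by (intro power_decreasing) (auto simp: a_def)
    finally show ?thesis by (simp add: mult_left_mono power_add power_divide)
  qed
  have "{f \<in> choices. \<not> expanding f} \<subseteq> (\<Union>i\<in>{..<k - 1}. bad i)"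
  proof
    fix f assume f: "f \<in> {f \<in> choices. \<not> expanding f}"
    then obtain i where "Suc i < k" "f \<in> bad i"
      unfolding expanding_def bad_def a_def by blast
    then show "f \<in> (\<Union>i\<in>{..<k - 1}. bad i)" by auto
  qed
  then have "card {f \<in> choices. \<not> expanding f} \<le> card (\<Union>i\<in>{..<k - 1}. bad i)"
    by (intro card_mono) (auto simp: bad_def)
  then have "real (card {f \<in> choices. \<not> expanding f}) \<le> real (card (\<Union>i\<in>{..<k - 1}. bad i))"
    by simp
  also have "\<dots> \<le> (\<Sum>i\<in>{..<k - 1}. real (card choices) * (1 / (4 * 2 ^ k)))"
    by (intro real_card_UN_le bound) auto
  also have "\<dots> = real (card choices) / 4 * (real (k - 1) / 2 ^ k)" by simp
  also have "\<dots> \<le> real (card choices) / 4 * 1"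
  proof (intro mult_left_mono)
    have "k - 1 \<le> ?K" using kK by linarith
    then have "real (k - 1) \<le> 2 ^ k" by (metis of_nat_le_iff of_nat_numeral of_nat_power)
    then show "real (k - 1) / 2 ^ k \<le> 1" by simp
  qed simp
  finally show ?thesis by simp
qed

lemma good_choice_exists: "\<exists>f\<in>choices. sparse f \<and> expanding f"
proof (rule ccontr)
  assume "\<not> ?thesis"
  then have "choices \<subseteq> {f \<in> choices. \<not> sparse f} \<union> {f \<in> choices. \<not> expanding f}" by blast
  then have "card choices \<le> card ({f \<in> choices. \<not> sparse f} \<union> {f \<in> choices. \<not> expanding f})"
    by (intro card_mono finite_UnI finite_Collect_conjI disjI1) simp_all
  also have "\<dots> \<le> card {f \<in> choices. \<not> sparse f} + card {f \<in> choices. \<not> expanding f}"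
    by (rule card_Un_le)
  finally show False using card_not_sparse card_not_expanding card_choices_pos by linarith
qed

section \<open>Hall ratio and degree weights\<close>

text \<open>
  The level \<open>s\<close> is the first one after which the levels together have size at most \<open>\<epsilon> t / k\<close>. Since
  \<open>s - 1\<close> does not qualify, \<open>t\<close> is less than \<open>2 k n\<^sub>s / \<epsilon>\<close>, so \<open>sparse\<close> covers all sets of at most \<open>2 t\<close>
  vertices before level \<open>s\<close> and yields three colours; level \<open>s\<close> itself takes the fourth. The factor
  \<open>k\<close> in the bound on the remaining levels pays for the at most \<open>k\<close> edges that each of their vertices
  sends on to later levels.
\<close>

lemma colourable_core:
  assumes f: "f \<in> choices" "sparse f" and eps: "0 < \<epsilon>" "4 * real k \<le> \<epsilon> * (2 ^ k) ^ 2"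
  obtains s where "s < k" "real k * real (card {v \<in> V. s < lev v}) \<le> \<epsilon> * real t"
    "\<And>X. X \<subseteq> {v \<in> V. lev v \<le> s} \<Longrightarrow> card X \<le> 2 * t \<Longrightarrow> colourable 4 X (edges f)"
proof -
  let ?P = "\<lambda>s. real k * real (card {v \<in> V. s < lev v}) \<le> \<epsilon> * real t"
  define s where "s = (LEAST s. ?P s)"
  have top: "?P (k - 1)"
  proof -
    have "{v \<in> V. k - 1 < lev v} = {}" using lev_less by fastforce
    then show ?thesis using eps(1) by (simp only: card.empty) simp
  qed
  have Ps: "?P s" unfolding s_def by (rule LeastI[of ?P, OF top])
  have "s \<le> k - 1" unfolding s_def by (rule Least_le[of ?P, OF top])
  then have sk: "s < k" using k_pos by simp
  have "colourable 4 X (edges f)" if X: "X \<subseteq> {v \<in> V. lev v \<le> s}" "card X \<le> 2 * t" for X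
  proof -
    have "finite X" using X(1) by (rule finite_subset) simp
    have "colourable 3 (X - level s) (edges f)"
    proof (rule colourable_if_sparse)
      fix Y assume Y: "Y \<subseteq> X - level s" "Y \<noteq> {}"
      then have Ys: "Y \<subseteq> {v \<in> V. lev v < s}" using X(1) by (force simp: level_def)
      then obtain r where r: "s = Suc r" using Y(2) by (cases s) auto
      have "\<not> ?P r" using not_less_Least[of r ?P] r by (simp add: s_def)
      moreover have "{v \<in> V. r < lev v} = {v \<in> V. s \<le> lev v}" using r by auto
      ultimately have "\<epsilon> * real t < real k * real (card {v \<in> V. s \<le> lev v})" by simp
      also have "\<dots> \<le> real k * real (2 * card (level s))"
        using card_upper_levels[OF sk] by (intro mult_left_mono of_nat_mono) auto
      finally have "\<epsilon> * (2 * real t) < (4 * real k) * real (card (level s))" by simp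
      also have "\<dots> \<le> (\<epsilon> * (2 ^ k) ^ 2) * real (card (level s))"
        using eps(2) by (intro mult_right_mono) auto
      finally have "2 * real t < (2 ^ k) ^ 2 * real (card (level s))"
        using eps(1) by (simp add: mult.assoc)
      then have "real (2 * t) < real ((2 ^ k) ^ 2 * card (level s))" by simp
      then have "2 * t < (2 ^ k) ^ 2 * card (level s)" by (simp only: of_nat_less_iff)
      moreover have "card Y \<le> card X" using Y \<open>finite X\<close> by (intro card_mono) auto
      ultimately have "card Y \<le> (2 ^ k) ^ 2 * card (level s)" using X(2) by linarith
      then have "2 * card (inner_slots f Y) < 3 * card Y"
        using f(2) Ys Y(2) sk unfolding sparse_def r by blast
      then show "2 * card {e \<in> edges f. e \<subseteq> Y} < 3 * card Y"
        using card_edges_le_inner_slots[of f Y] by linarith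
    qed (use \<open>finite X\<close> edges_subset[OF f(1)] in \<open>auto simp: nsets_def\<close>)
    then have "colourable (Suc 3) X (edges f)"
      using indep_level[OF f(1)] by (rule colourable_Suc)
    then show ?thesis by simp
  qed
  with sk Ps show thesis by (intro that) auto
qed

lemma independence_number_ge:
  assumes f: "f \<in> choices" "sparse f" and eps: "0 < \<epsilon>" "4 * real k \<le> \<epsilon> * (2 ^ k) ^ 2"
    and W: "W \<subseteq> V" "F \<subseteq> edges f"
  shows "(1 - \<epsilon>) * real (card W) / 4 \<le> real (independence_number W F)"
proof -
  obtain s where s: "s < k" "real k * real (card {v \<in> V. s < lev v}) \<le> \<epsilon> * real (card W)"
    "\<And>X. X \<subseteq> {v \<in> V. lev v \<le> s} \<Longrightarrow> card X \<le> 2 * card W \<Longrightarrow> colourable 4 X (edges f)"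
    using colourable_core[OF f eps] by blast
  have fW: "finite W" using W(1) finite_V by (rule finite_subset)
  define U where "U = {v \<in> W. lev v \<le> s}"
  have "card U \<le> card W" using fW by (intro card_mono) (auto simp: U_def)
  then have "colourable 4 U (edges f)" using W(1) by (intro s(3)) (auto simp: U_def)
  then obtain I where I: "I \<subseteq> U" "indep I (edges f)" "(\<Sum>v\<in>U. 1) / real 4 \<le> (\<Sum>v\<in>I. 1 :: real)"
    using colourable_heavy_indep_set[of U 4 "edges f" "\<lambda>_. 1"] fW by (auto simp: U_def)
  have "I \<in> indep_sets W F"
    using I(1,2) W(2) by (auto simp: indep_sets_def indep_def U_def)
  then have "card I \<le> independence_number W F"
    unfolding independence_number_def using fW by (intro Max_ge finite_imageI finite_indep_sets) auto
  moreover have "W = U \<union> {v \<in> W. s < lev v}" by (auto simp: U_def)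
  then have "card W \<le> card U + card {v \<in> W. s < lev v}" by (metis card_Un_le)
  moreover have "card {v \<in> W. s < lev v} \<le> card {v \<in> V. s < lev v}"
    using W(1) by (intro card_mono) auto
  moreover have "1 * real (card {v \<in> V. s < lev v}) \<le> real k * real (card {v \<in> V. s < lev v})"
    using k_pos by (intro mult_right_mono) auto
  ultimately show ?thesis using I(3) s(2) by (simp add: algebra_simps)
qed

lemma hall_ratio_le:
  assumes f: "f \<in> choices" "sparse f"
    and eps: "0 < \<epsilon>" "\<epsilon> < 1" "4 * real k \<le> \<epsilon> * (2 ^ k) ^ 2"
  shows "hall_ratio V (edges f) \<le> 4 / (1 - \<epsilon>)"
proof -
  have G: "simple_graph V (edges f)" using edges_subset[OF f(1)] by (simp add: simple_graph_def)
  let ?S = "{real (card W) / real (independence_number W F) | W F. subgraph W F V (edges f) \<and> W \<noteq> {}}"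
  have "V \<noteq> {}" using card_V_pos by auto
  then have "?S \<noteq> {}" using G by (auto simp: subgraph_def)
  moreover have "real (card W) / real (independence_number W F) \<le> 4 / (1 - \<epsilon>)"
    if "subgraph W F V (edges f)" "W \<noteq> {}" for W F
  proof -
    have W: "finite W" "W \<subseteq> V" "F \<subseteq> edges f" using that by (auto simp: subgraph_def simple_graph_def)
    have "0 < independence_number W F"
      "(1 - \<epsilon>) * real (card W) / 4 \<le> real (independence_number W F)"
      by (rule independence_number_pos[OF W(1) that(2)], rule independence_number_ge[OF f eps(1,3) W(2,3)])
    then show ?thesis using eps(2) by (simp add: divide_simps mult_ac)
  qed
  ultimately show ?thesis
    unfolding hall_ratio_def using finite_hall_ratio_values[OF G] by (auto simp: Max_le_iff)
qed

text \<open>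
  An edge both of whose ends lie after level \<open>s\<close> is chosen by a vertex after level \<open>s\<close>, so there are
  at most \<open>\<epsilon> |F|\<close> of these. Each of the other edges of \<open>F\<close> contributes to the degree of some vertex in
  the levels up to \<open>s\<close>, and only the at most \<open>2 |F|\<close> vertices that meet \<open>F\<close> have to be coloured.
\<close>

lemma weighted_independence_number_deg_ge:
  assumes f: "f \<in> choices" "sparse f" and eps: "0 < \<epsilon>" "4 * real k \<le> \<epsilon> * (2 ^ k) ^ 2"
    and H: "subgraph W F V (edges f)"
  shows "(1 - \<epsilon>) * real (card F) / 4
    \<le> weighted_independence_number V (edges f) (\<lambda>v. real (deg_weight W F v))"
proof -
  obtain s where s: "s < k" "real k * real (card {v \<in> V. s < lev v}) \<le> \<epsilon> * real (card F)"
    "\<And>X. X \<subseteq> {v \<in> V. lev v \<le> s} \<Longrightarrow> card X \<le> 2 * card F \<Longrightarrow> colourable 4 X (edges f)"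
    using colourable_core[OF f eps] by blast
  have W: "finite W" "W \<subseteq> V" "F \<subseteq> edges f" "F \<subseteq> [W]\<^bsup>2\<^esup>"
    using H by (auto simp: subgraph_def simple_graph_def)
  have finF: "finite F" using W(3) by (rule finite_subset) simp
  define U where "U = {v \<in> W. lev v \<le> s \<and> (\<exists>e\<in>F. v \<in> e)}"
  have "card U \<le> card (\<Union>e\<in>F. e)"
    using W(4) finF by (intro card_mono) (auto simp: U_def nsets_def)
  also have "\<dots> \<le> (\<Sum>e\<in>F. card e)" using finF by (rule card_UN_le)
  also have "\<dots> = (\<Sum>e\<in>F. 2)" using W(4) by (intro sum.cong) (auto simp: nsets_def)
  finally have "card U \<le> 2 * card F" by simp
  then have "colourable 4 U (edges f)" using W(2) by (intro s(3)) (auto simp: U_def)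
  moreover have "finite U" using W(1) by (simp add: U_def)
  ultimately obtain I where I: "I \<subseteq> U" "indep I (edges f)"
    "(\<Sum>v\<in>U. real (deg_weight W F v)) / real 4 \<le> (\<Sum>v\<in>I. real (deg_weight W F v))"
    using colourable_heavy_indep_set[of U 4 "edges f" "\<lambda>v. real (deg_weight W F v)"] by auto
  have "I \<in> indep_sets V (edges f)"
    using I(1,2) W(2) by (auto simp: indep_sets_def U_def)
  then have le: "(\<Sum>v\<in>I. real (deg_weight W F v))
      \<le> weighted_independence_number V (edges f) (\<lambda>v. real (deg_weight W F v))"
    unfolding weighted_independence_number_def
    by (intro Max_ge finite_imageI finite_indep_sets) auto
  let ?D = "{e \<in> F. \<forall>v\<in>e. s < lev v}"
  have "card ?D \<le> k * card {v \<in> V. s < lev v}"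
  proof -
    have "?D \<subseteq> (\<lambda>p. {fst p, f p}) ` ({v \<in> V. s < lev v} \<times> {..<k})"
      using W(3) by (auto simp: edges_def slots_def image_iff) fastforce
    then have "card ?D \<le> card ((\<lambda>p. {fst p, f p}) ` ({v \<in> V. s < lev v} \<times> {..<k}))"
      by (intro card_mono) auto
    also have "\<dots> \<le> card ({v \<in> V. s < lev v} \<times> {..<k})" by (intro card_image_le) auto
    finally show ?thesis by (simp add: card_cartesian_product mult.commute)
  qed
  then have D: "real (card ?D) \<le> real k * real (card {v \<in> V. s < lev v})"
    by (simp only: of_nat_le_iff flip: of_nat_mult)
  have "card (F - ?D) = (\<Sum>e\<in>F - ?D. 1)" by simp
  also have "\<dots> \<le> (\<Sum>e\<in>F - ?D. card {v \<in> U. v \<in> e})"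
  proof (intro sum_mono)
    fix e assume "e \<in> F - ?D"
    then have "{v \<in> U. v \<in> e} \<noteq> {}" using W(4) by (fastforce simp: U_def nsets_def not_less)
    then show "1 \<le> card {v \<in> U. v \<in> e}"
      using \<open>finite U\<close> by (simp add: Suc_le_eq card_gt_0_iff)
  qed
  also have "\<dots> \<le> (\<Sum>e\<in>F. card {v \<in> U. v \<in> e})" using finF by (intro sum_mono2) auto
  also have "\<dots> = (\<Sum>v\<in>U. card {e \<in> F. v \<in> e})"
    using sum.swap_restrict[OF \<open>finite U\<close> finF, of "\<lambda>_ _. 1::nat" "\<lambda>v e. v \<in> e"] by simp
  also have "\<dots> = (\<Sum>v\<in>U. deg_weight W F v)"
    by (intro sum.cong) (auto simp: U_def deg_weight_def)
  finally have "card (F - ?D) \<le> (\<Sum>v\<in>U. deg_weight W F v)" .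
  moreover have "card F \<le> card (F - ?D) + card ?D"
    using finF by (simp add: card_Diff_subset card_mono)
  ultimately have "card F \<le> (\<Sum>v\<in>U. deg_weight W F v) + card ?D" by linarith
  then have "real (card F) \<le> (\<Sum>v\<in>U. real (deg_weight W F v)) + real (card ?D)"
    by (simp only: of_nat_le_iff flip: of_nat_sum of_nat_add)
  then show ?thesis using le I(3) D s(2) by (simp add: algebra_simps)
qed

section \<open>Fractional chromatic number\<close>

lemma indep_set_level_density_le:
  assumes f: "f \<in> choices" "expanding f" and I: "I \<in> indep_sets V (edges f)" and i: "Suc i < k"
    and dense: "ln (12 * real k) \<le> (\<Sum>j\<in>{i<..<k}. real (card (level j \<inter> I)) / real (card (level j)))"
  shows "real (card (level i \<inter> I)) / real (card (level i)) \<le> 1 / real k"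
proof -
  have "card (level i \<inter> I) \<le> card (level i) div k"
  proof (rule ccontr)
    assume "\<not> ?thesis"
    then have "Suc (card (level i) div k) \<le> card (level i \<inter> I)" by simp
    then obtain A where A: "A \<subseteq> level i \<inter> I" "card A = Suc (card (level i) div k)"
      using obtain_subset_with_card_n by metis
    define J where "J = I \<inter> {v \<in> V. i < lev v}"
    have "level j \<inter> J = level j \<inter> I" if "j \<in> {i<..<k}" for j
      using that by (auto simp: J_def level_def)
    then have "ln (12 * real k) \<le> (\<Sum>j\<in>{i<..<k}. real (card (level j \<inter> J)) / real (card (level j)))"
      using dense by simp
    moreover have "A \<subseteq> level i" "J \<subseteq> {v \<in> V. i < lev v}" using A(1) by (auto simp: J_def)
    ultimately obtain v j where v: "v \<in> A" "j \<in> {i<..<k}" "f (v, j) \<in> J"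
      using f(2)[unfolded expanding_def, rule_format, of i A J] i A(2) by blast
    have "(v, j) \<in> slots" using v(1,2) A(1) by (auto simp: slots_def level_def)
    then have "{v, f (v, j)} \<in> edges f" by (force simp: edges_def)
    moreover have "v \<noteq> f (v, j)" using v(1,3) A(1) by (auto simp: J_def level_def)
    moreover have "v \<in> I" "f (v, j) \<in> I" using v A(1) by (auto simp: J_def)
    ultimately show False using I by (auto simp: indep_sets_def indep_def)
  qed
  then have "card (level i \<inter> I) * k \<le> card (level i)"
    using k_pos by (simp add: less_eq_div_iff_mult_less_eq)
  then have "real (card (level i \<inter> I)) * real k \<le> real (card (level i))"
    by (simp only: of_nat_le_iff flip: of_nat_mult)
  then show ?thesis using k_pos card_level_pos[of i] i by (simp add: divide_simps mult_ac)
qed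

text \<open>
  Reading the levels from the last to the first, the densities add up to less than \<open>log (12 k)\<close>
  until some level \<open>i\<close>. That level adds at most one, and the at most \<open>k\<close> levels before it add at most
  \<open>1 / k\<close> each.
\<close>

lemma indep_set_total_density_le:
  assumes f: "f \<in> choices" "expanding f" and I: "I \<in> indep_sets V (edges f)"
  shows "(\<Sum>j<k. real (card (level j \<inter> I)) / real (card (level j))) \<le> ln (12 * real k) + 2"
proof -
  define x where "x j = real (card (level j \<inter> I)) / real (card (level j))" for j
  let ?S = "\<lambda>i. \<Sum>j\<in>{i<..<k}. x j"
  define i where "i = (LEAST i. ?S i < ln (12 * real k))"
  have top: "?S (k - 1) < ln (12 * real k)"
  proof -
    have "{k - 1<..<k} = {}" by auto
    then show ?thesis using k_pos by simp
  qed
  have Si: "?S i < ln (12 * real k)"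
    unfolding i_def by (rule LeastI[of "\<lambda>i. ?S i < ln (12 * real k)", OF top])
  have "i \<le> k - 1"
    unfolding i_def by (rule Least_le[of "\<lambda>i. ?S i < ln (12 * real k)", OF top])
  then have ik: "i < k" using k_pos by simp
  have "x j \<le> 1 / real k" if "j < i" for j
  proof -
    have "\<not> ?S j < ln (12 * real k)" using that unfolding i_def by (rule not_less_Least)
    then show ?thesis
      unfolding x_def using that ik by (intro indep_set_level_density_le[OF f I]) auto
  qed
  then have "(\<Sum>j<i. x j) \<le> (\<Sum>j<i. 1 / real k)" by (intro sum_mono) auto
  also have "\<dots> \<le> 1" using ik by simp
  finally have low: "(\<Sum>j<i. x j) \<le> 1" .
  have "card (level i \<inter> I) \<le> card (level i)" by (intro card_mono) auto
  then have xi: "x i \<le> 1" unfolding x_def by (intro divide_le_eq_1[THEN iffD2]) linarith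
  have "{..<k} = insert i ({..<i} \<union> {i<..<k})" using ik by auto
  then have "(\<Sum>j<k. x j) = x i + (\<Sum>j\<in>{..<i} \<union> {i<..<k}. x j)" by simp
  also have "(\<Sum>j\<in>{..<i} \<union> {i<..<k}. x j) = (\<Sum>j<i. x j) + ?S i"
    by (intro sum.union_disjoint) auto
  finally have "(\<Sum>j<k. x j) = x i + ((\<Sum>j<i. x j) + ?S i)" .
  then show ?thesis using low xi Si by (simp add: x_def)
qed

lemma fractional_chromatic_number_edges_ge:
  assumes f: "f \<in> choices" "expanding f"
  shows "real k / (ln (12 * real k) + 2) \<le> fractional_chromatic_number V (edges f)"
proof -
  define w where "w v = 1 / real (card (level (lev v)))" for v
  have weight: "(\<Sum>v\<in>I. w v) = (\<Sum>j<k. real (card (level j \<inter> I)) / real (card (level j)))"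
    if "I \<subseteq> V" for I
  proof -
    have "finite I" using that finite_V by (rule finite_subset)
    then have "(\<Sum>v\<in>I. w v) = (\<Sum>j<k. \<Sum>v | v \<in> I \<and> lev v = j. w v)"
      using that lev_less by (intro sum.group[symmetric]) auto
    also have "\<dots> = (\<Sum>j<k. real (card (level j \<inter> I)) / real (card (level j)))"
    proof (intro sum.cong refl)
      fix j
      have "{v. v \<in> I \<and> lev v = j} = level j \<inter> I" using that by (auto simp: level_def)
      moreover have "(\<Sum>v\<in>level j \<inter> I. w v) = (\<Sum>v\<in>level j \<inter> I. 1 / real (card (level j)))"
        by (intro sum.cong) (auto simp: w_def level_def)
      ultimately show "(\<Sum>v | v \<in> I \<and> lev v = j. w v) = real (card (level j \<inter> I)) / real (card (level j))"
        by simp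
    qed
    finally show ?thesis .
  qed
  have "(\<Sum>v\<in>V. w v) = (\<Sum>j<k. 1)"
    unfolding weight[OF order.refl]
  proof (intro sum.cong refl)
    fix j assume "j \<in> {..<k}"
    moreover have "level j \<inter> V = level j" using level_subset by auto
    ultimately show "real (card (level j \<inter> V)) / real (card (level j)) = 1"
      using level_nonempty[of j] by simp
  qed
  moreover have "(\<Sum>v\<in>V. w v) / (ln (12 * real k) + 2) \<le> fractional_chromatic_number V (edges f)"
  proof (rule fractional_chromatic_number_ge)
    have "1 \<le> 12 * real k" using k_pos by simp
    then show "0 < ln (12 * real k) + 2" using ln_ge_zero[of "12 * real k"] by linarith
    show "(\<Sum>v\<in>I. w v) \<le> ln (12 * real k) + 2" if "I \<in> indep_sets V (edges f)" for I
      using weight[of I] indep_set_total_density_le[OF f that] that by (simp add: indep_sets_def)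
  qed (auto simp: w_def)
  ultimately show ?thesis by simp
qed

end

section \<open>Sizes and number of the levels\<close>

lemma level_function_exists:
  "\<exists>lev :: nat \<Rightarrow> nat. (\<forall>v < (\<Sum>s<k. a s). lev v < k) \<and>
     (\<forall>s<k. card {v. v < (\<Sum>s<k. a s) \<and> lev v = s} = a s)"
proof (induction k)
  case (Suc k)
  then obtain lev :: "nat \<Rightarrow> nat" where
    lev: "\<forall>v < (\<Sum>s<k. a s). lev v < k" "\<forall>s<k. card {v. v < (\<Sum>s<k. a s) \<and> lev v = s} = a s"
    by blast
  let ?n = "\<Sum>s<k. a s"
  let ?l = "\<lambda>v. if v < ?n then lev v else k"
  have "card {v. v < (\<Sum>s<Suc k. a s) \<and> ?l v = s} = a s" if "s < Suc k" for s
  proof (cases "s = k")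
    case True
    then have "{v. v < (\<Sum>s<Suc k. a s) \<and> ?l v = s} = {?n..<?n + a k}"
      using lev(1) by (auto simp: not_less[symmetric])
    then show ?thesis using True by simp
  next
    case False
    then have "{v. v < (\<Sum>s<Suc k. a s) \<and> ?l v = s} = {v. v < ?n \<and> lev v = s}" by auto
    then show ?thesis using False that lev(2) by simp
  qed
  moreover have "\<forall>v < (\<Sum>s<Suc k. a s). ?l v < Suc k" using lev(1) by (auto intro: less_SucI)
  ultimately show ?case by (intro exI[of _ ?l]) blast
qed simp

text \<open>
  Put \<open>n\<^sub>s = \<lfloor>n / D\<^sub>s\<rfloor>\<close> with \<open>D\<^sub>s = B\<close> to the power \<open>3\<^sup>s - 1\<close>, so that \<open>D\<^sub>s\<^sub>+\<^sub>1 = B\<^sup>2 D\<^sub>s\<^sup>3\<close>. Rounding loses at most a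
  factor of two in each size, which costs a factor of eight in the cube, so any
  \<open>B \<ge> 8 \<cdot> 576 \<cdot> 2\<^bsup>6 k\<^esup>\<close> works; \<open>2\<^bsup>13\<^esup>\<close> is the power of two above \<open>8 \<cdot> 576\<close>. The vertices that are left
  over go to level 0, which gets at least half of all vertices.
\<close>

lemma shrinking_sizes_exist:
  assumes k: "0 < k" and n: "(2 ^ (13 + 6 * k)) ^ (3 ^ k) \<le> n"
  obtains a :: "nat \<Rightarrow> nat" where "(\<Sum>s<k. a s) = n" "\<And>s. s < k \<Longrightarrow> 0 < a s"
    "\<And>s. Suc s < k \<Longrightarrow> 576 * (2 ^ k) ^ 6 * n ^ 2 * a (Suc s) \<le> a s ^ 3"
proof -
  define B :: nat where "B = 2 ^ (13 + 6 * k)"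
  define D where "D s = B ^ (3 ^ s - 1)" for s :: nat
  define a where "a s = (if s = 0 then n - (\<Sum>s=1..<k. n div D s) else n div D s)" for s
  have B0: "0 < B" by (simp add: B_def)
  have D0: "0 < D s" for s using B0 by (simp add: D_def)
  have BK: "B = 8192 * (2 ^ k) ^ 6"
    by (simp add: B_def power_add power_mult mult.commute[of 6] flip: power_mult)
  have kB: "2 * k \<le> B"
  proof -
    have "2 * k \<le> 2 * 2 ^ k" using less_exp[of k] by linarith
    also have "\<dots> = 2 ^ Suc k" by simp
    also have "\<dots> \<le> B" unfolding B_def by (intro power_increasing) auto
    finally show ?thesis .
  qed
  have n0: "0 < n" using n B0 unfolding B_def[symmetric] by (meson less_le_trans zero_less_power)
  have Dn: "D s \<le> n" if "s < k" for s
  proof -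
    have "(3::nat) ^ s \<le> 3 ^ k" using that by (intro power_increasing) auto
    then have "(3::nat) ^ s - 1 \<le> 3 ^ k" by linarith
    then have "D s \<le> B ^ 3 ^ k" unfolding D_def using B0 by (intro power_increasing) auto
    then show ?thesis using n by (simp add: B_def)
  qed
  have "2 * (\<Sum>s=1..<k. n div D s) \<le> 2 * (\<Sum>s=1..<k. n div B)"
  proof (intro mult_le_mono sum_mono order.refl)
    fix s assume "s \<in> {1..<k}"
    then have "(3::nat) ^ 1 \<le> 3 ^ s" by (intro power_increasing) auto
    then have "(1::nat) \<le> 3 ^ s - 1" by simp
    then have "B ^ 1 \<le> D s" unfolding D_def using B0 by (intro power_increasing) auto
    then show "n div D s \<le> n div B" using B0 by (intro div_le_mono2) auto
  qed
  also have "\<dots> = 2 * (k - 1) * (n div B)" by simp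
  also have "\<dots> \<le> B * (n div B)" using kB by (intro mult_le_mono) auto
  also have "\<dots> \<le> n" by simp
  finally have half: "2 * (\<Sum>s=1..<k. n div D s) \<le> n" .
  have na: "n \<le> 2 * D s * a s" if "s < k" for s
  proof (cases "s = 0")
    case True
    then show ?thesis using half by (simp add: a_def D_def)
  next
    case False
    have "1 \<le> n div D s" using Dn[OF that] D0[of s] by (simp add: Suc_le_eq div_greater_zero_iff)
    then have "D s \<le> D s * (n div D s)" by simp
    moreover have "n < D s + D s * (n div D s)" by (rule dividend_less_times_div[OF D0])
    ultimately have "n \<le> 2 * (D s * (n div D s))" by linarith
    then show ?thesis using False by (simp add: a_def mult.assoc)
  qed
  have "{..<k} = insert 0 {1..<k}" using k by auto
  then have "(\<Sum>s<k. a s) = a 0 + (\<Sum>s=1..<k. a s)" by simp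
  also have "(\<Sum>s=1..<k. a s) = (\<Sum>s=1..<k. n div D s)" by (intro sum.cong) (auto simp: a_def)
  finally have sum: "(\<Sum>s<k. a s) = n" using half by (simp add: a_def)
  have pos: "0 < a s" if "s < k" for s
    using na[OF that] n0 by (cases "a s") auto
  have growth: "576 * (2 ^ k) ^ 6 * n ^ 2 * a (Suc s) \<le> a s ^ 3" if "Suc s < k" for s
  proof -
    have "(3::nat) ^ Suc s - 1 = (3 ^ s - 1) * 3 + 2"
      using one_le_power[of "3::nat" s] unfolding power_Suc by linarith
    then have DS: "D (Suc s) = D s ^ 3 * B ^ 2" unfolding D_def
      by (simp only: power_add power_mult)
    have "8 * (576 * (2 ^ k) ^ 6) \<le> B" by (simp add: BK)
    also have "\<dots> \<le> B ^ 2" using B0 by (simp add: power2_eq_square)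
    finally have B2: "8 * (576 * (2 ^ k) ^ 6) \<le> B ^ 2" .
    have "(8 * D s ^ 3) * (576 * (2 ^ k) ^ 6 * n ^ 2 * a (Suc s))
        = (D s ^ 3 * (8 * (576 * (2 ^ k) ^ 6))) * (n ^ 2 * a (Suc s))" by (simp only: mult_ac)
    also have "\<dots> \<le> D (Suc s) * (n ^ 2 * a (Suc s))"
      unfolding DS by (intro mult_le_mono B2 order.refl)
    also have "\<dots> = n ^ 2 * (D (Suc s) * (n div D (Suc s)))" by (simp add: a_def)
    also have "\<dots> \<le> n ^ 2 * n" by (intro mult_le_mono) auto
    also have "\<dots> = n ^ 3" by (simp add: power2_eq_square power3_eq_cube)
    also have "\<dots> \<le> (2 * D s * a s) ^ 3" using na[of s] that by (intro power_mono) auto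
    also have "\<dots> = (8 * D s ^ 3) * a s ^ 3" by (simp add: power_mult_distrib)
    finally show ?thesis by (rule mult_left_le_imp_le) (use D0[of s] in simp)
  qed
  show thesis using sum pos growth by (rule that)
qed

text \<open>
  About \<open>log log n / 10\<close> levels. The constraint on \<open>n\<close> is \<open>3\<^sup>k (13 + 6 k) log 2 \<le> log n\<close>; as
  \<open>3 \<le> exp 2\<close>, its left side is at most \<open>(log n)\<^bsup>1/5\<^esup>\<close> up to a factor of order \<open>log log n\<close>. The
  resulting bound on the fractional chromatic number is asymptotic to
  \<open>log log n / (10 log log log n)\<close>, which leaves a factor of five to absorb lower order terms.
\<close>

lemma number_of_levels_exists:
  fixes \<epsilon> :: real
  assumes "0 < \<epsilon>"
  shows "\<forall>\<^sub>F n :: nat in sequentially. \<exists>k. 0 < k \<and> (2 ^ (13 + 6 * k)) ^ (3 ^ k) \<le> n \<and>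
    4 * real k \<le> \<epsilon> * (2 ^ k) ^ 2 \<and>
    ln (ln (real n)) / (50 * ln (ln (ln (real n)))) \<le> real k / (ln (12 * real k) + 2)"
proof -
  define k where "k n = nat \<lfloor>ln (ln (real n)) / 10\<rfloor>" for n :: nat
  have "filterlim k at_top sequentially" unfolding k_def by real_asymp
  moreover have "\<forall>\<^sub>F k :: nat in sequentially. 4 * real k \<le> \<epsilon> * (2 ^ k) ^ 2"
    using assms by real_asymp
  ultimately have E1: "\<forall>\<^sub>F n in sequentially. 4 * real (k n) \<le> \<epsilon> * (2 ^ k n) ^ 2"
    by (rule eventually_compose_filterlim[rotated])
  have E2: "\<forall>\<^sub>F n :: nat in sequentially. 1 \<le> ln (ln (real n)) / 10" by real_asymp
  have E3: "\<forall>\<^sub>F n :: nat in sequentially. exp (2 * (ln (ln (real n)) / 10)) *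
      (13 + 6 * (ln (ln (real n)) / 10)) \<le> ln (real n)" by real_asymp
  have E4: "\<forall>\<^sub>F n :: nat in sequentially. ln (ln (real n)) / (50 * ln (ln (ln (real n))))
      \<le> (ln (ln (real n)) / 10 - 1) / (ln (12 * (ln (ln (real n)) / 10)) + 2)" by real_asymp
  show ?thesis
    using E1 E2 E3 E4 eventually_gt_at_top[of 0]
  proof eventually_elim
    case (elim n)
    let ?y = "ln (ln (real n)) / 10"
    have k: "real (k n) \<le> ?y" "?y - 1 \<le> real (k n)" "0 < k n"
      using elim(2) unfolding k_def by linarith+
    have "ln (real ((2 ^ (13 + 6 * k n)) ^ (3 ^ k n)))
        = 3 ^ k n * ((13 + 6 * real (k n)) * ln 2)"
      by (simp add: ln_realpow flip: power_mult)
    also have "\<dots> \<le> exp 2 ^ k n * ((13 + 6 * real (k n)) * 1)"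
      using exp_ge_add_one_self[of "2 :: real"] ln_2_less_1
      by (intro mult_mono power_mono) auto
    also have "\<dots> = exp (2 * real (k n)) * (13 + 6 * real (k n))"
      by (simp add: mult.commute[of 2] flip: exp_of_nat_mult)
    also have "\<dots> \<le> exp (2 * ?y) * (13 + 6 * ?y)"
      using k elim(2) by (intro mult_mono) auto
    also have "\<dots> \<le> ln (real n)" by (rule elim(3))
    finally have "real ((2 ^ (13 + 6 * k n)) ^ (3 ^ k n)) \<le> real n"
      using elim(5) by (subst (asm) ln_le_cancel_iff) auto
    then have n: "(2 ^ (13 + 6 * k n)) ^ (3 ^ k n) \<le> n" by (simp only: of_nat_le_iff)
    have "1 \<le> real (k n)" using k(3) by simp
    then have l: "0 \<le> ln (12 * real (k n))" by simp
    moreover have "ln (12 * real (k n)) \<le> ln (12 * ?y)" using k by (intro ln_mono) auto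
    ultimately have "(?y - 1) / (ln (12 * ?y) + 2) \<le> real (k n) / (ln (12 * real (k n)) + 2)"
      using k(2) by (intro frac_le) linarith+
    then show ?case using elim(1,4) k(3) n by (intro exI[of _ "k n"]) auto
  qed
qed

section \<open>Existence of the graphs\<close>

theorem theorem1p5:
  fixes \<delta> :: real
  assumes "\<delta> > 0"
  shows "\<exists>N. \<forall>n\<ge>N. \<exists>(V :: nat set) E.
    simple_graph V E \<and> card V = n \<and>
    fractional_chromatic_number V E \<ge> ln (ln (real n)) / (50 * ln (ln (ln (real n)))) \<and>
    hall_ratio V E \<le> 4 + \<delta> \<and>
    (\<forall>W F. subgraph W F V E \<longrightarrow>
      weighted_independence_number V E (\<lambda>v. real (deg_weight W F v)) \<ge> real (card F) / (4 + \<delta>))"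
proof -
  \<comment> \<open>This choice makes \<open>4 / (1 - \<epsilon>)\<close> equal to \<open>4 + \<delta>\<close>.\<close>
  define \<epsilon> where "\<epsilon> = \<delta> / (4 + \<delta>)"
  have eps: "0 < \<epsilon>" "\<epsilon> < 1" "1 - \<epsilon> = 4 / (4 + \<delta>)"
    using assms by (simp_all add: \<epsilon>_def field_simps)
  have quarter: "(1 - \<epsilon>) * c / 4 = c / (4 + \<delta>)" for c
    unfolding eps(3) using assms by (simp add: divide_simps)
  obtain N where N: "\<And>n. n \<ge> N \<Longrightarrow> \<exists>k. 0 < k \<and> (2 ^ (13 + 6 * k)) ^ (3 ^ k) \<le> n \<and>
    4 * real k \<le> \<epsilon> * (2 ^ k) ^ 2 \<and>
    ln (ln (real n)) / (50 * ln (ln (ln (real n)))) \<le> real k / (ln (12 * real k) + 2)"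
    using number_of_levels_exists[OF eps(1)] unfolding eventually_sequentially by blast
  show ?thesis
  proof (intro exI[of _ N] allI impI)
    fix n assume "N \<le> n"
    then obtain k where k: "0 < k" "(2 ^ (13 + 6 * k)) ^ (3 ^ k) \<le> n"
      "4 * real k \<le> \<epsilon> * (2 ^ k) ^ 2"
      "ln (ln (real n)) / (50 * ln (ln (ln (real n)))) \<le> real k / (ln (12 * real k) + 2)"
      using N by blast
    obtain a where a: "(\<Sum>s<k. a s) = n" "\<And>s. s < k \<Longrightarrow> 0 < a s"
      "\<And>s. Suc s < k \<Longrightarrow> 576 * (2 ^ k) ^ 6 * n ^ 2 * a (Suc s) \<le> a s ^ 3"
      using shrinking_sizes_exist[OF k(1,2)] by blast
    obtain lev :: "nat \<Rightarrow> nat" where lev: "\<forall>v<n. lev v < k"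
      "\<forall>s<k. card {v. v < n \<and> lev v = s} = a s"
      using level_function_exists[where a = a and k = k] unfolding a(1) by blast
    interpret levelled_set "{..<n}" lev k
    proof
      fix s assume "s < k"
      then have "card {v. v < n \<and> lev v = s} \<noteq> 0" using lev(2) a(2)[of s] by simp
      then have "{v. v < n \<and> lev v = s} \<noteq> {}" by (metis card.empty)
      then show "\<exists>v\<in>{..<n}. lev v = s" by auto
    qed (use lev(1) in auto)
    have card_level: "card (level s) = a s" if "s < k" for s
      using lev(2) that by (simp add: level_def)
    interpret shrinking_levels "{..<n}" lev k
    proof
      fix s assume "Suc s < k"
      then show "576 * (2 ^ k) ^ 6 * card {..<n} ^ 2 * card (level (Suc s)) \<le> card (level s) ^ 3"
        using a(3)[of s] by (simp add: card_level)
    qed (rule k(1))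
    obtain f where f: "f \<in> choices" "sparse f" "expanding f" using good_choice_exists by blast
    have "simple_graph {..<n} (edges f)" using edges_subset[OF f(1)] by (simp add: simple_graph_def)
    moreover have "ln (ln (real n)) / (50 * ln (ln (ln (real n))))
        \<le> fractional_chromatic_number {..<n} (edges f)"
      using k(4) fractional_chromatic_number_edges_ge[OF f(1,3)] by linarith
    moreover have "hall_ratio {..<n} (edges f) \<le> 4 + \<delta>"
      using hall_ratio_le[OF f(1,2) eps(1,2) k(3)] eps(3) by simp
    moreover have "real (card F) / (4 + \<delta>)
        \<le> weighted_independence_number {..<n} (edges f) (\<lambda>v. real (deg_weight W F v))"
      if "subgraph W F {..<n} (edges f)" for W F
      using weighted_independence_number_deg_ge[OF f(1,2) eps(1) k(3) that] by (simp only: quarter)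
    ultimately show "\<exists>(V :: nat set) E. simple_graph V E \<and> card V = n \<and>
      fractional_chromatic_number V E \<ge> ln (ln (real n)) / (50 * ln (ln (ln (real n)))) \<and>
      hall_ratio V E \<le> 4 + \<delta> \<and>
      (\<forall>W F. subgraph W F V E \<longrightarrow>
        weighted_independence_number V E (\<lambda>v. real (deg_weight W F v)) \<ge> real (card F) / (4 + \<delta>))"
      by (intro exI[of _ "{..<n}"] exI[of _ "edges f"]) auto
  qed
qed

end
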